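(* Let $H$ be the boundary complex of the $12$-dimensional hyperoctahedron (cross-polytope), and let $Y\subsetneq H$ be a full-dimensional subcomplex which is shellable, but such that for no facet $F$ of $H$ outside of $Y$ is $Y\cup\overline F$ shellable (such a $Y$ exists by a result of H. T. Hall). Let $X$ be the subcomplex of $H$ generated by $H\setminus Y$. Then $X$ is a full-dimensional Cohen-Macaulay subcomplex of $H$ which is not shellable (but $X$ is constructible).
   Context: $H$ is the join $\partial\Delta(A_1)*\cdots*\partial\Delta(A_{12})$ with disjoint sets $|A_i|=2$, where $\partial\Delta(A_i)$ is the complex of all proper subsets of $A_i$. A full-dimensional subcomplex has the same dimension as $H$; shellable complexes are understood to be pure. $\overline F$ denotes the simplicial complex of all subsets of $F$. The subcomplex generated by a set of faces consists of all subsets of these faces. Cohen-Macaulay is over a fixed field $k$. A simplicial complex $X$ of dimension $d$ is constructible if either $X$ is a simplex of dimension $d$, or $X=Y\cup Z$ where $Y,Z$ are constructible of dimension $d$ and $Y\cap Z$ is constructible of dimension $d-1$. *)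

theory Defs
  imports Main "HOL-Library.Disjoint_Sets"
begin

text \<open>
  Finite abstract simplicial complexes, represented by their sets of faces. The empty set is
  always a face, so the void complex is excluded and the smallest complex is \<open>{{}}\<close>,
  of dimension \<open>-1\<close>; dimensions are therefore integers.
\<close>

definition simplicial_complex :: "'a set set \<Rightarrow> bool" where
  "simplicial_complex K \<longleftrightarrow>
     finite K \<and> {} \<in> K \<and> (\<forall>F\<in>K. finite F) \<and> (\<forall>F\<in>K. \<forall>G. G \<subseteq> F \<longrightarrow> G \<in> K)"

definition face_dim :: "'a set \<Rightarrow> int" where
  "face_dim F = int (card F) - 1"

definition complex_dim :: "'a set set \<Rightarrow> int" where
  "complex_dim K = Max (face_dim ` K)"

definition facets :: "'a set set \<Rightarrow> 'a set set" where
  "facets K = {F \<in> K. \<forall>G\<in>K. F \<subseteq> G \<longrightarrow> G = F}"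

definition pure_of_dim :: "int \<Rightarrow> 'a set set \<Rightarrow> bool" where
  "pure_of_dim d K \<longleftrightarrow> simplicial_complex K \<and> (\<forall>F\<in>facets K. face_dim F = d)"

definition full_dim_subcomplex :: "'a set set \<Rightarrow> 'a set set \<Rightarrow> bool" where
  "full_dim_subcomplex Y K \<longleftrightarrow>
     simplicial_complex Y \<and> Y \<subseteq> K \<and> complex_dim Y = complex_dim K"

definition generated_complex :: "'a set set \<Rightarrow> 'a set set" where
  "generated_complex S = {G. \<exists>F\<in>S. G \<subseteq> F}"

definition boundary_of_simplex :: "'a set \<Rightarrow> 'a set set" where
  "boundary_of_simplex A = {F. F \<subset> A}"

definition join_family :: "'i set \<Rightarrow> ('i \<Rightarrow> 'a set set) \<Rightarrow> 'a set set" where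
  "join_family I K = {\<Union>i\<in>I. F i |F. \<forall>i\<in>I. F i \<in> K i}"

definition link :: "'a set set \<Rightarrow> 'a set \<Rightarrow> 'a set set" where
  "link K F = {G. F \<inter> G = {} \<and> F \<union> G \<in> K}"

text \<open>
  Shellable complexes are pure. A shelling lists the facets so that each facet after the first
  meets the complex generated by its predecessors in a pure complex of codimension one.
\<close>

definition is_shelling :: "'a set set \<Rightarrow> 'a set list \<Rightarrow> bool" where
  "is_shelling K Fs \<longleftrightarrow>
     distinct Fs \<and> set Fs = facets K \<and>
     (\<forall>j. 0 < j \<and> j < length Fs \<longrightarrow>
        pure_of_dim (complex_dim K - 1) ((\<Union>i<j. Pow (Fs ! i)) \<inter> Pow (Fs ! j)))"

definition shellable :: "'a set set \<Rightarrow> bool" where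
  "shellable K \<longleftrightarrow> pure_of_dim (complex_dim K) K \<and> (\<exists>Fs. is_shelling K Fs)"

inductive constructible_of_dim :: "int \<Rightarrow> 'a set set \<Rightarrow> bool" where
  simplex: "finite F \<Longrightarrow> face_dim F = d \<Longrightarrow> constructible_of_dim d (Pow F)"
| union: "constructible_of_dim d Y \<Longrightarrow> constructible_of_dim d Z \<Longrightarrow>
    constructible_of_dim (d - 1) (Y \<inter> Z) \<Longrightarrow> constructible_of_dim d (Y \<union> Z)"

definition constructible :: "'a set set \<Rightarrow> bool" where
  "constructible K \<longleftrightarrow> constructible_of_dim (complex_dim K) K"

text \<open>
  Reduced simplicial homology over a field, via oriented chains, so that no ordering of the
  vertices has to be chosen. The list \<open>[v0, ..., vi]\<close> stands for the oriented simplex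
  spanned by its entries, and \<open>c [v0, ..., vi]\<close> for the coefficient of that oriented simplex
  in the chain \<open>c\<close>; an odd permutation of the vertices reverses the orientation and hence the
  sign (adjacent transpositions generate all permutations). The empty list is the simplex of
  dimension \<open>-1\<close>, which makes the chain complex the augmented one.
\<close>

definition oriented_chain :: "'a set set \<Rightarrow> int \<Rightarrow> ('a list \<Rightarrow> 'k::field) \<Rightarrow> bool" where
  "oriented_chain K i c \<longleftrightarrow>
     (\<forall>xs. c xs \<noteq> 0 \<longrightarrow> distinct xs \<and> set xs \<in> K \<and> int (length xs) = i + 1) \<and>
     (\<forall>xs x y ys. c (xs @ y # x # ys) = - c (xs @ x # y # ys))"

text \<open>
  The usual formula, sending \<open>[v0, ..., vi]\<close> to the alternating sum of the simplices with
  one vertex omitted, read off coefficientwise: the oriented simplex \<open>xs\<close> occurs with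
  coefficient \<open>1\<close> in the boundary of \<open>v # xs\<close>.
\<close>

definition chain_boundary :: "'a set set \<Rightarrow> ('a list \<Rightarrow> 'k::field) \<Rightarrow> 'a list \<Rightarrow> 'k" where
  "chain_boundary K c xs = (\<Sum>v\<in>\<Union>K. c (v # xs))"

definition reduced_homology_vanishes :: "'k::field itself \<Rightarrow> 'a set set \<Rightarrow> int \<Rightarrow> bool" where
  "reduced_homology_vanishes k K i \<longleftrightarrow>
     (\<forall>c :: 'a list \<Rightarrow> 'k.
        oriented_chain K i c \<and> chain_boundary K c = (\<lambda>_. 0) \<longrightarrow>
        (\<exists>b. oriented_chain K (i + 1) b \<and> chain_boundary K b = c))"

text \<open>
  The Cohen-Macaulay property of a simplicial complex over the field \<open>'k\<close>, in its
  homological form: the reduced homology of every link (including the complex itself, the link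
  of the empty face) vanishes below the dimension of the link.
\<close>

definition cohen_macaulay :: "'k::field itself \<Rightarrow> 'a set set \<Rightarrow> bool" where
  "cohen_macaulay k K \<longleftrightarrow>
     simplicial_complex K \<and>
     (\<forall>F\<in>K. \<forall>i < complex_dim (link K F). reduced_homology_vanishes k (link K F) i)"

end

theory Submission
  imports Defs
begin

text \<open>
  The dual graph of the complement of a shelled set of facets of a cross-polytope is connected,
  and so is its part consisting of the facets that contain a given face.

  Suppose the complement of \<open>Y\<close> had a shelling, with last facet \<open>F\<close>. By connectedness applied to
  the other facets of this shelling, \<open>F\<close> meets \<open>Y\<close> in a pure complex of codimension one, so that
  \<open>F\<close> extends a shelling of \<open>Y\<close>.

  For constructibility, split \<open>X\<close> into the stars of two opposite vertices \<open>a\<close>, \<open>b\<close>. The links of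
  \<open>a\<close> and \<open>b\<close> in \<open>Y\<close>, and also their union (the projection of \<open>Y\<close> along \<open>a\<close>, \<open>b\<close>), are shelled
  in the cross-polytope of one dimension less. By connectedness the two stars of \<open>X\<close> meet exactly
  in the complement of that union, so induction on the dimension applies. A Mayer--Vietoris
  argument then gives the Cohen-Macaulay property.
\<close>

section \<open>Constructible complexes are Cohen-Macaulay\<close>

lemma simplicial_complex_Un:
  "simplicial_complex Y \<Longrightarrow> simplicial_complex Z \<Longrightarrow> simplicial_complex (Y \<union> Z)"
  unfolding simplicial_complex_def by (intro conjI) (simp, simp, blast, blast)

lemma simplicial_complex_Int:
  "simplicial_complex Y \<Longrightarrow> simplicial_complex Z \<Longrightarrow> simplicial_complex (Y \<inter> Z)"
  unfolding simplicial_complex_def by (intro conjI) (simp, simp, blast, blast)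

lemma constructible_of_dim_props:
  assumes "constructible_of_dim d K"
  shows "simplicial_complex K \<and> (\<forall>F\<in>K. face_dim F \<le> d) \<and> (\<exists>F\<in>K. face_dim F = d)"
  using assms
proof induction
  case (simplex F d)
  then show ?case
    by (auto simp: simplicial_complex_def face_dim_def finite_subset dest: card_mono)
next
  case (union d Y Z)
  then show ?case by (intro conjI simplicial_complex_Un) blast+
qed

lemma complex_dim_eqI:
  assumes "finite K" "\<And>F. F \<in> K \<Longrightarrow> face_dim F \<le> d" "\<exists>F\<in>K. face_dim F = d"
  shows "complex_dim K = d"
  unfolding complex_dim_def using assms by (intro Max_eqI) auto

lemma complex_dim_constructible:
  assumes "constructible_of_dim d K"
  shows "complex_dim K = d"
  using constructible_of_dim_props[OF assms]
  by (intro complex_dim_eqI) (auto simp: simplicial_complex_def)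

text \<open>Links commute with unions and intersections, so a decomposition of the complex induces
  one of the link, with every dimension lowered by \<open>card G\<close>.\<close>

lemma constructible_of_dim_link:
  assumes "constructible_of_dim d K" "G \<in> K"
  shows "constructible_of_dim (d - int (card G)) (link K G)"
  using assms
proof induction
  case (simplex F d)
  have eq: "link (Pow F) G = Pow (F - G)"
    using simplex by (auto simp: link_def)
  have "finite G" and "card G \<le> card F"
    using simplex by (auto intro: finite_subset card_mono)
  then show ?case
    unfolding eq using simplex
    by (intro constructible_of_dim.simplex) (auto simp: face_dim_def card_Diff_subset)
next
  case (union d Y Z)
  have sc: "simplicial_complex Y" "simplicial_complex Z"
    using union.hyps constructible_of_dim_props by blast+
  \<comment> \<open>A set that is not a face has the void link, so if \<open>G\<close> lies in only
    one piece, the link of the union is the link in that piece.\<close>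
  have down: "link Y G = {}" if "G \<notin> Y" using that sc(1)
    by (auto simp: link_def simplicial_complex_def)
  have down': "link Z G = {}" if "G \<notin> Z" using that sc(2)
    by (auto simp: link_def simplicial_complex_def)
  have un: "link (Y \<union> Z) G = link Y G \<union> link Z G"
    and int: "link (Y \<inter> Z) G = link Y G \<inter> link Z G"
    by (auto simp: link_def)
  show ?case
  proof (cases "G \<in> Y \<and> G \<in> Z")
    case True
    then have "constructible_of_dim (d - 1 - int (card G)) (link (Y \<inter> Z) G)"
      using union by auto
    then have "constructible_of_dim (d - int (card G) - 1) (link Y G \<inter> link Z G)"
      unfolding int by (simp add: algebra_simps)
    then show ?thesis
      unfolding un using True union by (intro constructible_of_dim.union) auto
  next
    case False
    then show ?thesis using union.IH(1,2) union.prems un down down' by auto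
  qed
qed

section \<open>Oriented chains and their boundaries\<close>

lemma finite_vertices: "simplicial_complex K \<Longrightarrow> finite (\<Union>K)"
  by (auto simp: simplicial_complex_def)

lemma oriented_chainI:
  assumes "\<And>xs. c xs \<noteq> 0 \<Longrightarrow> distinct xs \<and> set xs \<in> K \<and> int (length xs) = i + 1"
    and "\<And>xs x y ys. c (xs @ y # x # ys) = - c (xs @ x # y # ys)"
  shows "oriented_chain K i c"
  unfolding oriented_chain_def using assms by blast

lemma oriented_chain_support:
  "oriented_chain K i c \<Longrightarrow> c xs \<noteq> 0 \<Longrightarrow> distinct xs \<and> set xs \<in> K \<and> int (length xs) = i + 1"
  unfolding oriented_chain_def by blast

lemma oriented_chain_swap:
  "oriented_chain K i c \<Longrightarrow> c (xs @ y # x # ys) = - c (xs @ x # y # ys)"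
  unfolding oriented_chain_def by blast

lemma oriented_chain_mono: "oriented_chain K i c \<Longrightarrow> K \<subseteq> L \<Longrightarrow> oriented_chain L i c"
  unfolding oriented_chain_def by blast

lemma oriented_chain_zero: "oriented_chain K i (\<lambda>_. 0)"
  by (simp add: oriented_chain_def)

lemma oriented_chain_add:
  assumes "oriented_chain K i b" "oriented_chain K i c"
  shows "oriented_chain K i (\<lambda>xs. b xs + c xs)"
proof (rule oriented_chainI)
  show "distinct xs \<and> set xs \<in> K \<and> int (length xs) = i + 1" if "b xs + c xs \<noteq> 0" for xs
    using that oriented_chain_support[OF assms(1)] oriented_chain_support[OF assms(2)]
    by (metis add.right_neutral)
  show "b (xs @ y # x # ys) + c (xs @ y # x # ys) = - (b (xs @ x # y # ys) + c (xs @ x # y # ys))"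
    for xs x y ys
    unfolding oriented_chain_swap[OF assms(1), of xs y x] oriented_chain_swap[OF assms(2), of xs y x]
    by simp
qed

lemma oriented_chain_uminus:
  assumes "oriented_chain K i c"
  shows "oriented_chain K i (\<lambda>xs. - c xs)"
proof (rule oriented_chainI)
  show "distinct xs \<and> set xs \<in> K \<and> int (length xs) = i + 1" if "- c xs \<noteq> 0" for xs
    using that oriented_chain_support[OF assms, of xs] by simp
  show "- c (xs @ y # x # ys) = - (- c (xs @ x # y # ys))" for xs x y ys
    unfolding oriented_chain_swap[OF assms, of xs y x] ..
qed

lemma oriented_chain_diff:
  assumes "oriented_chain K i b" "oriented_chain K i c"
  shows "oriented_chain K i (\<lambda>xs. b xs - c xs)"
  using oriented_chain_add[OF assms(1) oriented_chain_uminus[OF assms(2)]] by simp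

text \<open>Transpositions preserve the vertex set, and \<open>P\<close> looks at nothing else, so
  antisymmetry survives. This cuts a chain into pieces along any set of faces.\<close>

lemma oriented_chain_restrict:
  assumes "oriented_chain K i c"
  shows "oriented_chain (K \<inter> {F. P F}) i (\<lambda>xs. if P (set xs) then c xs else 0)"
proof (rule oriented_chainI)
  show "distinct xs \<and> set xs \<in> K \<inter> {F. P F} \<and> int (length xs) = i + 1"
    if "(if P (set xs) then c xs else 0) \<noteq> 0" for xs
    using that oriented_chain_support[OF assms, of xs] by (simp split: if_splits)
  have "set (xs @ y # x # ys) = set (xs @ x # y # ys)" for x y and xs ys :: "'a list" by auto
  then show "(if P (set (xs @ y # x # ys)) then c (xs @ y # x # ys) else 0)
      = - (if P (set (xs @ x # y # ys)) then c (xs @ x # y # ys) else 0)" for xs x y ys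
    unfolding oriented_chain_swap[OF assms, of xs y x] by simp
qed

text \<open>Vertices outside \<open>K\<close> only contribute zero coefficients. Hence boundaries
  taken in different subcomplexes can all be computed in one ambient complex.\<close>

lemma chain_boundary_mono:
  assumes "oriented_chain K i c" "K \<subseteq> L" "simplicial_complex L"
  shows "chain_boundary L c = chain_boundary K c"
proof
  fix xs
  have "c (v # xs) = 0" if "v \<notin> \<Union>K" for v
    using oriented_chain_support[OF assms(1), of "v # xs"] that by auto
  then show "chain_boundary L c xs = chain_boundary K c xs"
    unfolding chain_boundary_def using assms finite_vertices
    by (intro sum.mono_neutral_right) auto
qed

lemma oriented_chain_boundary:
  assumes c: "oriented_chain K i c" and K: "simplicial_complex K"
  shows "oriented_chain K (i - 1) (chain_boundary K c)"
proof (rule oriented_chainI)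
  fix xs x y ys
  have "c (v # xs @ y # x # ys) = - c (v # xs @ x # y # ys)" for v
    using oriented_chain_swap[OF c, of "v # xs" y x ys] by simp
  then show "chain_boundary K c (xs @ y # x # ys) = - chain_boundary K c (xs @ x # y # ys)"
    by (simp add: chain_boundary_def sum_negf)
next
  fix xs assume "chain_boundary K c xs \<noteq> 0"
  then obtain v where "c (v # xs) \<noteq> 0"
    unfolding chain_boundary_def by (meson sum.neutral)
  then have *: "distinct (v # xs)" "set (v # xs) \<in> K" "int (length (v # xs)) = i + 1"
    using oriented_chain_support[OF c] by blast+
  have "set xs \<in> K"
    using *(2) K set_subset_Cons[of xs v] unfolding simplicial_complex_def by blast
  then show "distinct xs \<and> set xs \<in> K \<and> int (length xs) = i - 1 + 1" using * by auto
qed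

text \<open>Off-diagonal terms cancel in pairs. The diagonal is a separate assumption because in
  characteristic 2 antisymmetry does not force it to vanish.\<close>

lemma sum_antisymmetric:
  fixes f :: "'a \<Rightarrow> 'a \<Rightarrow> 'b::ab_group_add"
  assumes "finite V" "\<And>v w. f v w = - f w v" "\<And>v. f v v = 0"
  shows "(\<Sum>v\<in>V. \<Sum>w\<in>V. f v w) = 0"
  using assms(1)
proof induction
  case (insert x V)
  have "(\<Sum>v\<in>V. f v x) = - (\<Sum>w\<in>V. f x w)"
    unfolding sum_negf[symmetric] by (intro sum.cong refl assms(2))
  then show ?case using insert.hyps insert.IH assms(3) by (simp add: sum.distrib)
qed simp

lemma boundary_boundary:
  assumes c: "oriented_chain K i c" and K: "simplicial_complex K"
  shows "chain_boundary K (chain_boundary K c) = (\<lambda>_. 0)"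
proof
  fix xs
  show "chain_boundary K (chain_boundary K c) xs = 0"
    unfolding chain_boundary_def
  proof (rule sum_antisymmetric[OF finite_vertices[OF K]])
    show "c (w # v # xs) = - c (v # w # xs)" for v w
      using oriented_chain_swap[OF c, of "[]" w v xs] unfolding append_Nil .
    show "c (v # v # xs) = 0" for v
      using oriented_chain_support[OF c, of "v # v # xs"] by auto
  qed
qed

lemma chain_boundary_add:
  "chain_boundary K (\<lambda>xs. b xs + c xs) = (\<lambda>xs. chain_boundary K b xs + chain_boundary K c xs)"
  by (simp add: chain_boundary_def sum.distrib fun_eq_iff)

lemma chain_boundary_diff:
  "chain_boundary K (\<lambda>xs. b xs - c xs) = (\<lambda>xs. chain_boundary K b xs - chain_boundary K c xs)"
  by (simp add: chain_boundary_def sum_subtractf fun_eq_iff)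

text \<open>Adjacent transpositions move \<open>v\<close> to the front and change the sign of both
  chains alike, so lists starting with \<open>v\<close> determine all lists containing
  \<open>v\<close>.\<close>

lemma oriented_chain_eqI:
  assumes b: "oriented_chain K i b" and c: "oriented_chain K i c"
    and out: "\<And>xs. v \<notin> set xs \<Longrightarrow> b xs = c xs" and front: "\<And>xs. b (v # xs) = c (v # xs)"
  shows "b = c"
proof
  have move: "b (us @ v # ws) = c (us @ v # ws)" for us ws
  proof (induction us arbitrary: ws rule: rev_induct)
    case Nil
    then show ?case using front by simp
  next
    case (snoc u us)
    have "b (us @ u # v # ws) = - b (us @ v # u # ws)"
      "c (us @ u # v # ws) = - c (us @ v # u # ws)"
      using oriented_chain_swap[OF b] oriented_chain_swap[OF c] .
    then show ?case using snoc[of "u # ws"] by simp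
  qed
  fix xs show "b xs = c xs"
    using move out by (cases "v \<in> set xs") (auto simp: in_set_conv_decomp)
qed

text \<open>The chain \<open>v * c\<close>: the sign records the moves that bring \<open>v\<close> to the front.\<close>

primrec cone_chain :: "'a \<Rightarrow> ('a list \<Rightarrow> 'k::field) \<Rightarrow> 'a list \<Rightarrow> 'k" where
  "cone_chain v c [] = 0"
| "cone_chain v c (x # xs) = (if x = v then c xs else - cone_chain v (\<lambda>ys. c (x # ys)) xs)"

lemma cone_chain_notin: "v \<notin> set xs \<Longrightarrow> cone_chain v c xs = 0"
  by (induction xs arbitrary: c) auto

lemma cone_chain_nonzero:
  "cone_chain v c xs \<noteq> 0 \<Longrightarrow> \<exists>us ws. xs = us @ v # ws \<and> c (us @ ws) \<noteq> 0"
proof (induction xs arbitrary: c)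
  case (Cons x xs)
  show ?case
  proof (cases "x = v")
    case True
    then show ?thesis using Cons.prems by (intro exI[of _ "[]"] exI[of _ xs]) auto
  next
    case False
    then have "cone_chain v (\<lambda>ys. c (x # ys)) xs \<noteq> 0" using Cons.prems by simp
    from Cons.IH[OF this] obtain us ws where "xs = us @ v # ws" "c (x # us @ ws) \<noteq> 0"
      by blast
    then show ?thesis by (intro exI[of _ "x # us"] exI[of _ ws]) auto
  qed
qed simp

lemma cone_chain_antisym:
  assumes "\<And>xs x y ys. c (xs @ y # x # ys) = - c (xs @ x # y # ys)" "\<And>xs. v \<in> set xs \<Longrightarrow> c xs = 0"
  shows "cone_chain v c (xs @ y # x # ys) = - cone_chain v c (xs @ x # y # ys)"
  using assms
proof (induction xs arbitrary: c)
  case Nil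
  have "(\<lambda>zs. c (y # x # zs)) = (\<lambda>zs. - c (x # y # zs))"
    using Nil(1)[of "[]" y x] by simp
  moreover have "cone_chain v (\<lambda>zs. - c zs) zs = - cone_chain v c zs" for zs c
    by (induction zs arbitrary: c) auto
  \<comment> \<open>The vanishing of \<open>c\<close> on lists containing \<open>v\<close> settles
    the case \<open>x = y = v\<close>, where both sides are \<open>c (v # ys)\<close> up to
    sign.\<close>
  ultimately show ?case using Nil(2)[of "v # ys"] by (cases "x = v"; cases "y = v") auto
next
  case (Cons u xs)
  have swap: "c (u # us @ b # a # ws) = - c (u # us @ a # b # ws)" for us a b ws
    using Cons.prems(1)[of "u # us"] unfolding append_Cons .
  have zero: "c (u # zs) = 0" if "v \<in> set zs" for zs
    by (rule Cons.prems(2)) (simp add: that)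
  have "cone_chain v (\<lambda>zs. c (u # zs)) (xs @ y # x # ys)
      = - cone_chain v (\<lambda>zs. c (u # zs)) (xs @ x # y # ys)"
    by (rule Cons.IH; rule swap zero)
  then show ?case using Cons.prems(1)[of "[]"] Cons.prems(1)[of xs y x ys] by simp
qed

text \<open>Coning with a vertex \<open>v\<close> contracts the chain complex of a simplex: a cycle
  is the boundary of the cone over its \<open>v\<close>-free part.\<close>

lemma reduced_homology_vanishes_simplex:
  fixes F :: "'a set"
  assumes "finite F" and v: "v \<in> F"
  shows "reduced_homology_vanishes (k :: 'k::field itself) (Pow F) i"
  unfolding reduced_homology_vanishes_def
proof (intro allI impI, elim conjE)
  fix c :: "'a list \<Rightarrow> 'k"
  assume c: "oriented_chain (Pow F) i c" and cycle: "chain_boundary (Pow F) c = (\<lambda>_. 0)"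
  have K: "simplicial_complex (Pow F)"
    using assms by (auto simp: simplicial_complex_def finite_subset)
  \<comment> \<open>Faces already containing \<open>v\<close> cannot be coned with \<open>v\<close>;
    the cycle condition recovers the values of \<open>c\<close> on them.\<close>
  define c' where "c' = (\<lambda>xs. if v \<notin> set xs then c xs else 0)"
  have c': "oriented_chain (Pow F) i c'"
    unfolding c'_def using oriented_chain_restrict[OF c, of "\<lambda>G. v \<notin> G"]
    by (rule oriented_chain_mono) auto
  define b where "b = cone_chain v c'"
  have b: "oriented_chain (Pow F) (i + 1) b"
  proof (rule oriented_chainI)
    fix xs x y ys
    show "b (xs @ y # x # ys) = - b (xs @ x # y # ys)"
      unfolding b_def
    proof (rule cone_chain_antisym)
      show "c' (us @ z # w # ws) = - c' (us @ w # z # ws)" for us w z ws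
        by (rule oriented_chain_swap[OF c'])
    qed (simp add: c'_def)
  next
    fix xs assume "b xs \<noteq> 0"
    then obtain us ws where xs: "xs = us @ v # ws" and nz: "c' (us @ ws) \<noteq> 0"
      unfolding b_def using cone_chain_nonzero[of v c' xs] by blast
    then have "v \<notin> set (us @ ws)" by (auto simp: c'_def)
    then show "distinct xs \<and> set xs \<in> Pow F \<and> int (length xs) = i + 1 + 1"
      using xs v oriented_chain_support[OF c' nz] by auto
  qed
  have Db: "oriented_chain (Pow F) i (chain_boundary (Pow F) b)"
    using oriented_chain_boundary[OF b K] by simp
  have "chain_boundary (Pow F) b = c"
  proof (rule oriented_chain_eqI[OF Db c])
    fix xs assume xs: "v \<notin> set xs"
    \<comment> \<open>The chain \<open>b\<close> lives on lists containing \<open>v\<close>, so only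
      the term \<open>w = v\<close> of the boundary at \<open>xs\<close> survives.\<close>
    have "b (w # xs) = (if w = v then c xs else 0)" for w
      using xs by (auto simp: b_def c'_def cone_chain_notin)
    then show "chain_boundary (Pow F) b xs = c xs"
      using assms by (simp add: chain_boundary_def)
  next
    fix xs show "chain_boundary (Pow F) b (v # xs) = c (v # xs)"
    proof (cases "v \<in> set xs")
      case True
      then have "\<not> distinct (v # xs)" by simp
      then show ?thesis using oriented_chain_support[OF Db] oriented_chain_support[OF c] by metis
    next
      case False
      \<comment> \<open>The term \<open>w = v\<close> is cancelled, so the sum is minus the boundary
        of \<open>c\<close> at \<open>xs\<close> without its \<open>v\<close>-term. As
        \<open>c\<close> is a cycle, this leaves \<open>c (v # xs)\<close>.\<close>
      have "b (w # v # xs) = - (c (w # xs) - (if w = v then c (v # xs) else 0))" for w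
        using False by (auto simp: b_def c'_def)
      then have "chain_boundary (Pow F) b (v # xs)
          = - (chain_boundary (Pow F) c xs - c (v # xs))"
        using assms by (simp add: chain_boundary_def sum_negf sum_subtractf)
      then show ?thesis using cycle by simp
    qed
  qed
  then show "\<exists>b. oriented_chain (Pow F) (i + 1) b \<and> chain_boundary (Pow F) b = c"
    using b by blast
qed

text \<open>The Mayer-Vietoris argument on chains. Split \<open>c = p + q\<close> with
  \<open>p\<close> in \<open>Y\<close> and \<open>q\<close> in \<open>Z\<close>. The boundary of
  \<open>p\<close> is a cycle of the intersection, hence the boundary of some \<open>e\<close>
  there. Then \<open>p - e\<close> and \<open>q + e\<close> are cycles of \<open>Y\<close> and
  \<open>Z\<close>, and the chains that they bound add up to one bounded by
  \<open>c\<close>.\<close>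

lemma reduced_homology_vanishes_union:
  fixes Y Z :: "'a set set" and k :: "'k::field itself"
  assumes Y: "simplicial_complex Y" and Z: "simplicial_complex Z"
    and hY: "reduced_homology_vanishes k Y i" and hZ: "reduced_homology_vanishes k Z i"
    and hYZ: "reduced_homology_vanishes k (Y \<inter> Z) (i - 1)"
  shows "reduced_homology_vanishes k (Y \<union> Z) i"
  unfolding reduced_homology_vanishes_def
proof (intro allI impI, elim conjE)
  fix c :: "'a list \<Rightarrow> 'k"
  assume c: "oriented_chain (Y \<union> Z) i c" and cycle: "chain_boundary (Y \<union> Z) c = (\<lambda>_. 0)"
  have YZ: "simplicial_complex (Y \<union> Z)" "simplicial_complex (Y \<inter> Z)"
    using Y Z by (rule simplicial_complex_Un, rule simplicial_complex_Int)
  let ?D = "chain_boundary (Y \<union> Z)"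
  define p where "p = (\<lambda>xs. if set xs \<in> Y then c xs else 0)"
  define q where "q = (\<lambda>xs. if set xs \<notin> Y then c xs else 0)"
  have p: "oriented_chain Y i p"
    unfolding p_def using oriented_chain_restrict[OF c, of "\<lambda>G. G \<in> Y"]
    by (rule oriented_chain_mono) auto
  have q: "oriented_chain Z i q"
    unfolding q_def using oriented_chain_restrict[OF c, of "\<lambda>G. G \<notin> Y"]
    by (rule oriented_chain_mono) auto
  have DY: "?D x = chain_boundary Y x" if "oriented_chain Y j x" for j and x :: "'a list \<Rightarrow> 'k"
    using that YZ by (intro chain_boundary_mono) auto
  have DZ: "?D x = chain_boundary Z x" if "oriented_chain Z j x" for j and x :: "'a list \<Rightarrow> 'k"
    using that YZ by (intro chain_boundary_mono) auto
  have DYZ: "?D x = chain_boundary (Y \<inter> Z) x" if "oriented_chain (Y \<inter> Z) j x"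
    for j and x :: "'a list \<Rightarrow> 'k"
    using that YZ by (intro chain_boundary_mono) auto
  have "c = (\<lambda>xs. p xs + q xs)" by (auto simp: p_def q_def)
  then have sum0: "?D p xs + ?D q xs = 0" for xs
    using cycle by (metis chain_boundary_add)
  have Dp: "oriented_chain Y (i - 1) (?D p)" and Dq: "oriented_chain Z (i - 1) (?D q)"
    using oriented_chain_boundary[OF p Y] oriented_chain_boundary[OF q Z] DY[OF p] DZ[OF q] by auto
  \<comment> \<open>The two boundaries are negatives of each other and so have the same support,
    which must lie in both \<open>Y\<close> and \<open>Z\<close>.\<close>
  have "?D p xs \<noteq> 0 \<longleftrightarrow> ?D q xs \<noteq> 0" for xs using sum0[of xs] by auto
  then have Dp': "oriented_chain (Y \<inter> Z) (i - 1) (?D p)"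
    using oriented_chain_support[OF Dp] oriented_chain_support[OF Dq] oriented_chain_swap[OF Dp]
    by (intro oriented_chainI) blast+
  moreover have "chain_boundary (Y \<inter> Z) (?D p) = (\<lambda>_. 0)"
    using DYZ[OF Dp'] boundary_boundary[OF oriented_chain_mono[OF p] YZ(1)] by auto
  ultimately obtain e where e: "oriented_chain (Y \<inter> Z) i e" and De: "?D e = ?D p"
    using hYZ DYZ unfolding reduced_homology_vanishes_def by (metis diff_add_cancel)
  have eY: "oriented_chain Y i e" and eZ: "oriented_chain Z i e"
    using e by (auto intro: oriented_chain_mono)
  have pe: "oriented_chain Y i (\<lambda>xs. p xs - e xs)" and qe: "oriented_chain Z i (\<lambda>xs. q xs + e xs)"
    using oriented_chain_diff[OF p eY] oriented_chain_add[OF q eZ] .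
  have "chain_boundary Y (\<lambda>xs. p xs - e xs) = (\<lambda>_. 0)"
    using DY[OF pe] De by (simp add: chain_boundary_diff)
  then obtain r where r: "oriented_chain Y (i + 1) r" "?D r = (\<lambda>xs. p xs - e xs)"
    using hY pe DY unfolding reduced_homology_vanishes_def by metis
  have "chain_boundary Z (\<lambda>xs. q xs + e xs) = (\<lambda>_. 0)"
    using DZ[OF qe] De sum0 by (simp add: chain_boundary_add add.commute)
  then obtain s where s: "oriented_chain Z (i + 1) s" "?D s = (\<lambda>xs. q xs + e xs)"
    using hZ qe DZ unfolding reduced_homology_vanishes_def by metis
  have "oriented_chain (Y \<union> Z) (i + 1) (\<lambda>xs. r xs + s xs)"
    using r(1) s(1) by (intro oriented_chain_add) (auto intro: oriented_chain_mono)
  moreover have "?D (\<lambda>xs. r xs + s xs) = c"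
    using r(2) s(2) \<open>c = (\<lambda>xs. p xs + q xs)\<close> by (simp add: chain_boundary_add)
  ultimately show "\<exists>b. oriented_chain (Y \<union> Z) (i + 1) b \<and> ?D b = c" by blast
qed

lemma reduced_homology_vanishes_constructible:
  assumes "constructible_of_dim d K" "i < d"
  shows "reduced_homology_vanishes (k :: 'k::field itself) K i"
  using assms
proof (induction arbitrary: i)
  case (simplex F d)
  show ?case
  proof (cases "F = {}")
    case False
    then obtain v where "v \<in> F" by blast
    then show ?thesis by (rule reduced_homology_vanishes_simplex[OF simplex.hyps(1)])
  next
    case True
    \<comment> \<open>The empty simplex has no vertex to cone with. It has dimension -1, and below
      that degree every chain is zero because no list has negative length.\<close>
    then have "i + 1 < 0" using simplex by (simp add: face_dim_def)
    then have "c = (\<lambda>_. 0)" if "oriented_chain (Pow F) i c" for c :: "'a list \<Rightarrow> 'k"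
      using oriented_chain_support[OF that] by fastforce
    then show ?thesis
      unfolding reduced_homology_vanishes_def using oriented_chain_zero
      by (metis (no_types))
  qed
next
  case (union d Y Z)
  moreover have "simplicial_complex Y" "simplicial_complex Z"
    using union.hyps constructible_of_dim_props by blast+
  ultimately show ?case
    by (intro reduced_homology_vanishes_union) auto
qed

lemma cohen_macaulay_constructible:
  assumes "constructible_of_dim d K"
  shows "cohen_macaulay (k :: 'k::field itself) K"
  unfolding cohen_macaulay_def
  using assms constructible_of_dim_props constructible_of_dim_link complex_dim_constructible
    reduced_homology_vanishes_constructible by metis

section \<open>Shelled sets of facets of a cross-polytope\<close>

text \<open>
  The boundary of a cross-polytope is given by its vertex set \<open>V\<close> and the map \<open>opp\<close> that
  exchanges opposite vertices; its facets are the transversals.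
\<close>

definition antipodal :: "('a \<Rightarrow> 'a) \<Rightarrow> 'a set \<Rightarrow> bool" where
  "antipodal opp V \<longleftrightarrow>
     finite V \<and> (\<forall>v\<in>V. opp v \<in> V \<and> opp v \<noteq> v \<and> opp (opp v) = v)"

definition transversals :: "('a \<Rightarrow> 'a) \<Rightarrow> 'a set \<Rightarrow> 'a set set" where
  "transversals opp V = {F. F \<subseteq> V \<and> (\<forall>v\<in>V. opp v \<in> F \<longleftrightarrow> v \<notin> F)}"

text \<open>For a vertex \<open>v\<close> of a facet \<open>F\<close>, this is the neighbour of
  \<open>F\<close> across the ridge \<open>F - {v}\<close>.\<close>

definition flip :: "('a \<Rightarrow> 'a) \<Rightarrow> 'a \<Rightarrow> 'a set \<Rightarrow> 'a set" where
  "flip opp v F = insert (opp v) (F - {v})"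

text \<open>Shellings without the order: only the set of facets reached so far is kept. The
  condition says that \<open>F \<inter> G\<close> lies in a ridge \<open>F - {v}\<close> shared with
  an earlier facet. Taking \<open>G = F\<close> shows that \<open>F\<close> is new, since then no
  \<open>v\<close> exists.\<close>

inductive shelled :: "('a \<Rightarrow> 'a) \<Rightarrow> 'a set \<Rightarrow> 'a set set \<Rightarrow> bool"
  for opp V where
  empty: "shelled opp V {}"
| insert: "shelled opp V S \<Longrightarrow> F \<in> transversals opp V \<Longrightarrow>
    (\<And>G. G \<in> S \<Longrightarrow> \<exists>v\<in>F - G. flip opp v F \<in> S) \<Longrightarrow> shelled opp V (insert F S)"

section \<open>Transversals, flips and the removal of an antipodal pair\<close>

lemma antipodalD:
  assumes "antipodal opp V" "v \<in> V"
  shows "opp v \<in> V" "opp v \<noteq> v" "opp (opp v) = v"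
  using assms by (auto simp: antipodal_def)

lemma antipodal_finite: "antipodal opp V \<Longrightarrow> finite V"
  by (simp add: antipodal_def)

lemma antipodal_inj: "antipodal opp V \<Longrightarrow> v \<in> V \<Longrightarrow> w \<in> V \<Longrightarrow> opp v = opp w \<longleftrightarrow> v = w"
  unfolding antipodal_def by metis

lemma antipodal_diff:
  assumes "antipodal opp V" "a \<in> V"
  shows "antipodal opp (V - {a, opp a})"
  unfolding antipodal_def
proof (intro conjI ballI)
  show "finite (V - {a, opp a})" using antipodal_finite[OF assms(1)] by simp
  fix v assume "v \<in> V - {a, opp a}"
  then have "v \<in> V" "v \<noteq> a" "v \<noteq> opp a" by auto
  then show "opp v \<in> V - {a, opp a}" "opp v \<noteq> v" "opp (opp v) = v"
    using antipodalD[OF assms(1)] antipodal_inj[OF assms(1)] assms(2) by auto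
qed

lemma transversalD:
  assumes "F \<in> transversals opp V"
  shows "F \<subseteq> V" "v \<in> V \<Longrightarrow> opp v \<in> F \<longleftrightarrow> v \<notin> F"
  using assms by (auto simp: transversals_def)

lemma finite_transversals: "antipodal opp V \<Longrightarrow> finite (transversals opp V)"
  by (rule finite_subset[of _ "Pow V"]) (auto simp: transversals_def antipodal_def)

lemma transversal_subset_eq:
  assumes "F \<in> transversals opp V" "G \<in> transversals opp V" "F \<subseteq> G"
  shows "F = G"
  using assms unfolding transversals_def by blast

lemma flip_in_transversals:
  assumes "antipodal opp V" "F \<in> transversals opp V" "v \<in> F"
  shows "flip opp v F \<in> transversals opp V"
proof -
  have v: "v \<in> V" "opp v \<in> V" "opp v \<noteq> v" "opp (opp v) = v"
    using transversalD(1)[OF assms(2)] antipodalD[OF assms(1)] assms(3) by auto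
  have "opp u \<in> flip opp v F \<longleftrightarrow> u \<notin> flip opp v F" if u: "u \<in> V" for u
  proof -
    have "opp u = opp v \<longleftrightarrow> u = v" "opp u = v \<longleftrightarrow> u = opp v"
      using antipodal_inj[OF assms(1) u v(1)] antipodal_inj[OF assms(1) u v(2)] v(4) by simp_all
    then show ?thesis
      using transversalD(2)[OF assms(2) u] v(3) by (auto simp: flip_def)
  qed
  then show ?thesis using transversalD(1)[OF assms(2)] v by (auto simp: transversals_def flip_def)
qed

lemma flip_flip:
  assumes "antipodal opp V" "F \<in> transversals opp V" "v \<in> F"
  shows "opp v \<in> flip opp v F" "flip opp (opp v) (flip opp v F) = F"
proof -
  have v: "v \<in> V" using transversalD(1)[OF assms(2)] assms(3) by auto
  then have "opp v \<notin> F" using transversalD(2)[OF assms(2)] assms(3) by blast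
  then show "opp v \<in> flip opp v F" "flip opp (opp v) (flip opp v F) = F"
    using antipodalD[OF assms(1) v] assms(3) by (auto simp: flip_def)
qed

lemma card_transversal:
  assumes V: "antipodal opp V" and F: "F \<in> transversals opp V"
  shows "card V = 2 * card F"
proof -
  have FV: "F \<subseteq> V" using transversalD(1)[OF F] .
  have "V = F \<union> opp ` F"
  proof
    show "V \<subseteq> F \<union> opp ` F"
    proof
      fix v assume v: "v \<in> V"
      show "v \<in> F \<union> opp ` F"
        using transversalD(2)[OF F v] antipodalD(3)[OF V v] by (cases "v \<in> F") (auto, metis image_eqI)
    qed
    show "F \<union> opp ` F \<subseteq> V" using FV antipodalD(1)[OF V] by auto
  qed
  moreover have "F \<inter> opp ` F = {}" using transversalD(2)[OF F] FV by auto
  moreover have "inj_on opp F"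
    using antipodal_inj[OF V] FV by (intro inj_onI) blast
  moreover have "finite F" using FV antipodal_finite[OF V] finite_subset by blast
  ultimately show ?thesis by (simp add: card_Un_disjoint card_image)
qed

text \<open>Identifies the link of a vertex with the boundary of the cross-polytope on the remaining
  antipodal pairs.\<close>

lemma insert_transversal_iff:
  assumes V: "antipodal opp V" and a: "a \<in> V" and G: "a \<notin> G"
  shows "insert a G \<in> transversals opp V \<longleftrightarrow> G \<in> transversals opp (V - {a, opp a})"
proof -
  note a' = antipodalD[OF V a]
  have o: "opp v \<noteq> a \<and> opp v \<noteq> opp a" if "v \<in> V" "v \<noteq> a" "v \<noteq> opp a" for v
    using antipodal_inj[OF V that(1) a] antipodalD(3)[OF V that(1)] that by auto
  show ?thesis
  proof
    assume *: "insert a G \<in> transversals opp V"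
    have "opp a \<notin> G" using transversalD(2)[OF * a] by simp
    moreover have "opp v \<in> G \<longleftrightarrow> v \<notin> G" if "v \<in> V - {a, opp a}" for v
      using transversalD(2)[OF *, of v] o[of v] that by auto
    ultimately show "G \<in> transversals opp (V - {a, opp a})"
      using transversalD(1)[OF *] G by (auto simp: transversals_def)
  next
    assume *: "G \<in> transversals opp (V - {a, opp a})"
    have "opp v \<in> insert a G \<longleftrightarrow> v \<notin> insert a G" if "v \<in> V" for v
    proof (cases "v = a \<or> v = opp a")
      case True
      then show ?thesis using transversalD(1)[OF *] a' by auto
    next
      case False
      then show ?thesis using transversalD(2)[OF *, of v] o[of v] that by auto
    qed
    then show "insert a G \<in> transversals opp V"
      using transversalD(1)[OF *] a by (auto simp: transversals_def)
  qed
qed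

lemma transversal_remove:
  assumes V: "antipodal opp V" and a: "a \<in> V" and F: "F \<in> transversals opp V"
  shows "F - {a, opp a} \<in> transversals opp (V - {a, opp a})"
    and "F = insert a (F - {a, opp a}) \<or> F = insert (opp a) (F - {a, opp a})"
proof -
  note a' = antipodalD[OF V a]
  show *: "F = insert a (F - {a, opp a}) \<or> F = insert (opp a) (F - {a, opp a})"
    using transversalD(2)[OF F a] by auto
  \<comment> \<open>Both vertices of the pair remove the same pair, so the criterion applies with
    \<open>opp a\<close> in place of \<open>a\<close>.\<close>
  have "insert (opp (opp a)) {opp a} = {a, opp a}" using a' by auto
  then have "V - {opp a, opp (opp a)} = V - {a, opp a}" by auto
  then have "F - {a, opp a} \<in> transversals opp (V - {a, opp a}) \<longleftrightarrow>
      insert a (F - {a, opp a}) \<in> transversals opp V"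
    "F - {a, opp a} \<in> transversals opp (V - {a, opp a}) \<longleftrightarrow>
      insert (opp a) (F - {a, opp a}) \<in> transversals opp V"
    using insert_transversal_iff[OF V a, of "F - {a, opp a}"]
      insert_transversal_iff[OF V a'(1), of "F - {a, opp a}"] by simp_all
  then show "F - {a, opp a} \<in> transversals opp (V - {a, opp a})"
    using * F by metis
qed

section \<open>Shelled sets under links and projections, and their complements\<close>

lemma shelled_subset: "shelled opp V S \<Longrightarrow> S \<subseteq> transversals opp V"
  by (induction rule: shelled.induct) auto

text \<open>The shelling restricts to the facets through \<open>a\<close>: two such facets share
  \<open>a\<close>, so the vertex flipped for them is never \<open>a\<close> and the flip stays in
  the link.\<close>

lemma shelled_link:
  assumes S: "shelled opp V S" and V: "antipodal opp V" and a: "a \<in> V"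
  shows "shelled opp (V - {a, opp a}) {G. a \<notin> G \<and> insert a G \<in> S}"
  using S
proof induction
  case empty
  then show ?case by (simp add: shelled.empty)
next
  case (insert S F)
  show ?case
  proof (cases "a \<in> F")
    case False
    then have "{G. a \<notin> G \<and> insert a G \<in> insert F S} = {G. a \<notin> G \<and> insert a G \<in> S}" by auto
    then show ?thesis using insert.IH by simp
  next
    case True
    define L where "L = {G. a \<notin> G \<and> insert a G \<in> S}"
    have eq: "{G. a \<notin> G \<and> insert a G \<in> insert F S} = insert (F - {a}) L"
      using True unfolding L_def by auto
    have "shelled opp (V - {a, opp a}) (insert (F - {a}) L)"
    proof (rule shelled.insert)
      show "shelled opp (V - {a, opp a}) L" using insert.IH unfolding L_def .
      show "F - {a} \<in> transversals opp (V - {a, opp a})"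
        using insert_transversal_iff[OF V a, of "F - {a}"] insert.hyps(2) True
        by (simp add: insert_absorb)
      fix G assume "G \<in> L"
      then have "insert a G \<in> S" by (simp add: L_def)
      from insert.hyps(3)[OF this] obtain v where v: "v \<in> F" "v \<noteq> a" "v \<notin> G" "flip opp v F \<in> S"
        by auto
      have "v \<in> V" using v(1) transversalD(1)[OF insert.hyps(2)] by auto
      then have "opp v \<noteq> a" using transversalD(2)[OF insert.hyps(2), of v] v(1) True by auto
      then have "insert a (flip opp v (F - {a})) = flip opp v F" "a \<notin> flip opp v (F - {a})"
        using True v(2) by (auto simp: flip_def)
      then show "\<exists>v\<in>F - {a} - G. flip opp v (F - {a}) \<in> L"
        using v unfolding L_def by (intro bexI[of _ v]) auto
    qed
    then show ?thesis unfolding eq .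
  qed
qed

text \<open>A facet whose projection has occurred before is skipped. For the others the shelling
  order is kept, because the required flips commute with the projection.\<close>

lemma shelled_projection:
  assumes S: "shelled opp V S" and V: "antipodal opp V" and a: "a \<in> V"
  shows "shelled opp (V - {a, opp a}) ((\<lambda>F. F - {a, opp a}) ` S)"
  using S
proof induction
  case empty
  then show ?case by (simp add: shelled.empty)
next
  case (insert S F)
  let ?p = "\<lambda>F. F - {a, opp a}"
  show ?case
  proof (cases "?p F \<in> ?p ` S")
    case True
    then show ?thesis using insert.IH by (simp add: insert_absorb)
  next
    case False
    have "shelled opp (V - {a, opp a}) (insert (?p F) (?p ` S))"
    proof (rule shelled.insert[OF insert.IH])
      show "?p F \<in> transversals opp (V - {a, opp a})"
        by (rule transversal_remove(1)[OF V a insert.hyps(2)])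
      fix G' assume "G' \<in> ?p ` S"
      then obtain G where G: "G \<in> S" "G' = ?p G" by auto
      from insert.hyps(3)[OF G(1)] obtain v where v: "v \<in> F" "v \<notin> G" "flip opp v F \<in> S" by auto
      have vV: "v \<in> V" using v(1) transversalD(1)[OF insert.hyps(2)] by auto
      \<comment> \<open>Flipping within the pair would produce an earlier facet with the same
        projection, contrary to the projection of \<open>F\<close> being new.\<close>
      have va: "v \<noteq> a \<and> v \<noteq> opp a"
      proof (rule ccontr)
        assume "\<not> ?thesis"
        then have "?p (flip opp v F) = ?p F"
          using antipodalD[OF V a] by (auto simp: flip_def)
        then show False using False v(3) by (metis image_eqI)
      qed
      then have "opp v \<noteq> a" "opp v \<noteq> opp a"
        using antipodal_inj[OF V vV a] antipodalD(3)[OF V vV] by auto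
      then have "?p (flip opp v F) = flip opp v (?p F)" by (auto simp: flip_def)
      then have "flip opp v (?p F) \<in> ?p ` S" using v(3) by (metis image_eqI)
      then show "\<exists>v\<in>?p F - G'. flip opp v (?p F) \<in> ?p ` S"
        using v va G(2) by (intro bexI[of _ v]) auto
    qed
    then show ?thesis by simp
  qed
qed

text \<open>
  Connectedness of the dual graph of the complement: adding \<open>F\<close> to \<open>S\<close> keeps it connected,
  since two neighbours \<open>F\<^sub>v\<close>, \<open>F\<^sub>w\<close> of \<open>F\<close> outside \<open>S\<close> are joined by a path through \<open>F\<^sub>v\<^sub>w\<close>, which
  is outside \<open>S\<close> by the shelling condition.
\<close>

lemma shelled_complement_connected:
  assumes S: "shelled opp V S" and V: "antipodal opp V"
    and C: "C \<subseteq> {F \<in> transversals opp V - S. D \<subseteq> F}" "C \<noteq> {}"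
    and closed: "\<And>F v. F \<in> C \<Longrightarrow> v \<in> F - D \<Longrightarrow> flip opp v F \<notin> S \<Longrightarrow> flip opp v F \<in> C"
  shows "C = {F \<in> transversals opp V - S. D \<subseteq> F}"
  using S C closed
proof (induction arbitrary: C)
  case empty
  obtain F0 where F0: "F0 \<in> C" using empty by blast
  \<comment> \<open>Walk from \<open>F0\<close> towards \<open>G\<close> by flipping vertices of
    \<open>F0 - G\<close>. They lie outside \<open>D\<close> because \<open>D \<subseteq> G\<close>,
    and each flip shrinks the difference.\<close>
  have "G \<in> C" if G: "G \<in> transversals opp V" "D \<subseteq> G" for G
    using F0
  proof (induction "card (F0 - G)" arbitrary: F0 rule: less_induct)
    case less
    have F0: "F0 \<in> transversals opp V" using less.prems empty.prems(1) by auto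
    show ?case
    proof (cases "F0 \<subseteq> G")
      case True
      then show ?thesis using transversal_subset_eq[OF F0 G(1)] less.prems by simp
    next
      case False
      then obtain v where v: "v \<in> F0" "v \<notin> G" by blast
      have vV: "v \<in> V" using v transversalD(1)[OF F0] by auto
      have "flip opp v F0 \<in> C" using empty.prems(3)[OF less.prems, of v] v G(2) by auto
      moreover have "opp v \<in> G" using transversalD(2)[OF G(1) vV] v by simp
      then have "flip opp v F0 - G \<subset> F0 - G" using v by (auto simp: flip_def)
      then have "card (flip opp v F0 - G) < card (F0 - G)"
        using antipodal_finite[OF V] transversalD(1)[OF F0]
        by (intro psubset_card_mono) (auto intro: finite_subset)
      ultimately show ?thesis using less.hyps by blast
    qed
  qed
  then show ?case using empty.prems(1) by blast
next
  case (insert S F)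
  note F = insert.hyps(2)
  let ?P = "{F \<in> transversals opp V - S. D \<subseteq> F}"
  have FC: "F \<notin> C" and CP: "C \<subseteq> ?P" using insert.prems(1) by auto
  show ?case
  proof (cases "D \<subseteq> F \<and> (\<exists>w\<in>F - D. flip opp w F \<in> C)")
    case False
    \<comment> \<open>Here \<open>F\<close> is not adjacent to \<open>C\<close>: a flip from
      \<open>C\<close> to \<open>F\<close> could be undone at a vertex outside \<open>D\<close>. So
      \<open>C\<close> is also closed when only \<open>S\<close> is avoided.\<close>
    have "C = ?P"
    proof (rule insert.IH[OF CP insert.prems(2)])
      fix G v assume G: "G \<in> C" "v \<in> G - D" "flip opp v G \<notin> S"
      have GT: "G \<in> transversals opp V" using G(1) CP by auto
      have "flip opp v G \<noteq> F"
      proof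
        assume eq: "flip opp v G = F"
        then have "opp v \<in> F" "flip opp (opp v) F = G"
          using flip_flip[OF V GT] G(2) by auto
        moreover have "D \<subseteq> G" using G(1) CP by auto
        then have "D \<subseteq> F" using eq G(2) by (auto simp: flip_def)
        ultimately have "opp v \<in> D" using False G(1) by auto
        moreover have "v \<in> V" using transversalD(1)[OF GT] G(2) by auto
        ultimately show False using \<open>D \<subseteq> G\<close> G(2) transversalD(2)[OF GT] by blast
      qed
      then show "flip opp v G \<in> C" using insert.prems(3) G by auto
    qed
    then show ?thesis using FC by auto
  next
    case True
    then obtain w where DF: "D \<subseteq> F" and w: "w \<in> F" "w \<notin> D" "flip opp w F \<in> C" by auto
    have FS: "F \<notin> S" using insert.hyps(3) by blast
    have nbr: "flip opp v F \<in> C" if v: "v \<in> F - D" "flip opp v F \<notin> S" for v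
    proof (cases "v = w")
      case False
      have vV: "v \<in> V" and wV: "w \<in> V" using v w transversalD(1)[OF F] by auto
      have nF: "opp v \<notin> F" "opp w \<notin> F"
        using transversalD(2)[OF F vV] transversalD(2)[OF F wV] v w by auto
      note inj = antipodal_inj[OF V vV wV]
      have Fv: "flip opp v F \<in> transversals opp V" and Fw: "flip opp w F \<in> transversals opp V"
        using flip_in_transversals[OF V F] v w by auto
      have wFv: "w \<in> flip opp v F" and vFw: "v \<in> flip opp w F"
        using w v False by (auto simp: flip_def)
      define K where "K = flip opp v (flip opp w F)"
      have K': "K = flip opp w (flip opp v F)"
        using nF v w False inj unfolding K_def flip_def by auto
      have "F - K = {v, w}" using nF v w False unfolding K_def flip_def by auto
      \<comment> \<open>If \<open>K\<close> were in \<open>S\<close>, the shelling condition for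
        \<open>F\<close> against \<open>K\<close> would put \<open>flip opp v F\<close> or
        \<open>flip opp w F\<close> into \<open>S\<close>. So \<open>K\<close> gives a detour around
        \<open>F\<close> between these two neighbours.\<close>
      then have KS: "K \<notin> S"
        using insert.hyps(3)[of K] w(3) v(2) CP by auto
      have "K \<noteq> F" using \<open>F - K = {v, w}\<close> by auto
      then have KC: "K \<in> C"
        using insert.prems(3)[OF w(3), of v] vFw v KS unfolding K_def by auto
      have "flip opp (opp w) K = flip opp v F" "opp w \<in> K"
        unfolding K' using flip_flip[OF V Fv wFv] by auto
      moreover have "opp w \<notin> D" using DF nF by auto
      moreover have "flip opp v F \<noteq> F" using nF by (auto simp: flip_def)
      ultimately show ?thesis using insert.prems(3)[OF KC, of "opp w"] v by auto
    qed (use w in simp)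
    \<comment> \<open>With \<open>F\<close> no longer removed, its class is \<open>C\<close>
      together with \<open>F\<close>: all neighbours of \<open>F\<close> that count are already in
      \<open>C\<close>.\<close>
    have "insert F C = ?P"
    proof (rule insert.IH)
      show "insert F C \<subseteq> ?P" using CP F FS DF by auto
      fix G v assume G: "G \<in> insert F C" "v \<in> G - D" "flip opp v G \<notin> S"
      then show "flip opp v G \<in> insert F C"
        using nbr insert.prems(3)[of G v] by auto
    qed simp
    then show ?thesis using FC by auto
  qed
qed

section \<open>Constructibility of the complement\<close>

text \<open>The set of all \<open>G\<close> with \<open>G - {a} \<in> K\<close> is the cone over
  \<open>K\<close> with apex \<open>a\<close>. Coning commutes with unions and intersections and
  turns simplices into simplices.\<close>

lemma constructible_of_dim_cone:
  assumes "constructible_of_dim d K" "a \<notin> \<Union>K"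
  shows "constructible_of_dim (d + 1) {G. G - {a} \<in> K}"
  using assms
proof induction
  case (simplex F d)
  then have "{G. G - {a} \<in> Pow F} = Pow (insert a F)" by auto
  moreover have "a \<notin> F" using simplex by auto
  ultimately show ?case
    using simplex by (auto intro!: constructible_of_dim.simplex simp: face_dim_def)
next
  case (union d Y Z)
  have "{G. G - {a} \<in> Y \<union> Z} = {G. G - {a} \<in> Y} \<union> {G. G - {a} \<in> Z}"
    and int: "{G. G - {a} \<in> Y \<inter> Z} = {G. G - {a} \<in> Y} \<inter> {G. G - {a} \<in> Z}" by auto
  moreover have "constructible_of_dim (d - 1 + 1) {G. G - {a} \<in> Y \<inter> Z}"
    using union.IH(3) union.prems by blast
  then have "constructible_of_dim (d + 1 - 1) ({G. G - {a} \<in> Y} \<inter> {G. G - {a} \<in> Z})"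
    unfolding int by simp
  ultimately show ?case
    using union by (auto intro!: constructible_of_dim.union)
qed

lemma empty_mem_generated_complex: "{} \<in> generated_complex S \<longleftrightarrow> S \<noteq> {}"
  by (auto simp: generated_complex_def)

lemma generated_complex_empty: "generated_complex {} = {}"
  by (simp add: generated_complex_def)

text \<open>The induction ranges over all shelled sets, including the empty one, since the links of
  \<open>a\<close> and \<open>b\<close> and their union may be any of these.\<close>

lemma shelled_complement_constructible:
  assumes "antipodal opp V" "shelled opp V S" "S \<noteq> transversals opp V" "card V = 2 * n"
  shows "constructible_of_dim (int n - 1) (generated_complex (transversals opp V - S))"
  using assms
proof (induction n arbitrary: V S)
  case 0
  then have "V = {}" by (simp add: antipodal_def)
  then have T: "transversals opp V = {{}}" by (auto simp: transversals_def)
  then have "S = {}" using 0 shelled_subset[OF 0(2)] by auto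
  then have "generated_complex (transversals opp V - S) = Pow {}"
    using T by (auto simp: generated_complex_def)
  then show ?case
    using constructible_of_dim.simplex[of "{}" "-1"] by (simp add: face_dim_def)
next
  case (Suc n)
  note V = Suc.prems(1) and S = Suc.prems(2)
  obtain a where a: "a \<in> V" using Suc.prems(4) by fastforce
  define b where "b = opp a"
  define W where "W = V - {a, b}"
  have b: "b \<in> V" "b \<noteq> a" "opp b = a" using antipodalD[OF V a] by (auto simp: b_def)
  have Wb: "V - {b, opp b} = W" using b by (auto simp: W_def)
  have W: "antipodal opp W" using antipodal_diff[OF V a] by (simp add: W_def b_def)
  have cW: "card W = 2 * n"
    using Suc.prems(4) a b antipodal_finite[OF V] by (simp add: W_def card_Diff_subset)
  let ?T = "transversals opp"
  define Ya where "Ya = {G. a \<notin> G \<and> insert a G \<in> S}"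
  define Yb where "Yb = {G. b \<notin> G \<and> insert b G \<in> S}"
  have sYa: "shelled opp W Ya"
    using shelled_link[OF S V a] by (simp add: W_def b_def Ya_def)
  have sYb: "shelled opp W Yb"
    using shelled_link[OF S V b(1)] unfolding Wb Yb_def .
  have notin: "a \<notin> F \<and> b \<notin> F" if "F \<in> ?T W" for F
    using transversalD(1)[OF that] by (auto simp: W_def)
  have insa: "insert a F \<in> ?T V \<longleftrightarrow> F \<in> ?T W" if "a \<notin> F" for F
    using insert_transversal_iff[OF V a that] by (simp add: W_def b_def)
  have insb: "insert b F \<in> ?T V \<longleftrightarrow> F \<in> ?T W" if "b \<notin> F" for F
    using insert_transversal_iff[OF V b(1) that] unfolding Wb .
  have remove: "F - {a, b} \<in> ?T W \<and> (F = insert a (F - {a, b}) \<or> F = insert b (F - {a, b}))"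
    if "F \<in> ?T V" for F
    using transversal_remove[OF V a that] by (simp add: W_def b_def)
  have STV: "S \<subseteq> ?T V" using shelled_subset[OF S] .
  \<comment> \<open>Every facet contains exactly one of \<open>a\<close> and \<open>b\<close>, so
    its projection is a facet of the corresponding link.\<close>
  have proj: "(\<lambda>F. F - {a, opp a}) ` S = Ya \<union> Yb"
  proof
    show "(\<lambda>F. F - {a, opp a}) ` S \<subseteq> Ya \<union> Yb"
    proof
      fix G assume "G \<in> (\<lambda>F. F - {a, opp a}) ` S"
      then obtain F where F: "F \<in> S" "G = F - {a, b}" by (auto simp: b_def)
      then have "insert a G \<in> S \<or> insert b G \<in> S" using remove[of F] STV by (metis subsetD)
      then show "G \<in> Ya \<union> Yb" using F(2) by (auto simp: Ya_def Yb_def)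
    qed
    show "Ya \<union> Yb \<subseteq> (\<lambda>F. F - {a, opp a}) ` S"
    proof
      fix G assume G: "G \<in> Ya \<union> Yb"
      then have "G \<in> ?T W" using shelled_subset[OF sYa] shelled_subset[OF sYb] by auto
      then have "insert a G - {a, opp a} = G" "insert b G - {a, opp a} = G"
        using notin[of G] by (auto simp: b_def)
      then show "G \<in> (\<lambda>F. F - {a, opp a}) ` S"
        using G unfolding Ya_def Yb_def by (metis (no_types, lifting) UnE image_eqI mem_Collect_eq)
    qed
  qed
  have sYab: "shelled opp W (Ya \<union> Yb)"
    using shelled_projection[OF S V a] unfolding proj by (simp add: W_def b_def)
  define Xa where "Xa = generated_complex (?T W - Ya)"
  define Xb where "Xb = generated_complex (?T W - Yb)"
  have subW: "G \<subseteq> W" if "G \<in> Xa \<or> G \<in> Xb" for G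
    using that transversalD(1)[of _ opp W] unfolding Xa_def Xb_def generated_complex_def by blast
  \<comment> \<open>The complement is the union of the two stars, that is, of the cones over the
    complements of the two links.\<close>
  have split: "generated_complex (?T V - S) = {G. G - {a} \<in> Xa} \<union> {G. G - {b} \<in> Xb}"
  proof (intro equalityI subsetI)
    fix G assume "G \<in> generated_complex (?T V - S)"
    then obtain F where F: "F \<in> ?T V" "F \<notin> S" "G \<subseteq> F" by (auto simp: generated_complex_def)
    have F': "F - {a, b} \<in> ?T W" using remove[OF F(1)] by blast
    from remove[OF F(1)] consider "F = insert a (F - {a, b})" | "F = insert b (F - {a, b})" by blast
    then show "G \<in> {G. G - {a} \<in> Xa} \<union> {G. G - {b} \<in> Xb}"
    proof cases
      case 1
      then have "F - {a, b} \<notin> Ya" "G - {a} \<subseteq> F - {a, b}" using F by (auto simp: Ya_def)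
      then show ?thesis using F' by (auto simp: Xa_def generated_complex_def)
    next
      case 2
      then have "F - {a, b} \<notin> Yb" "G - {b} \<subseteq> F - {a, b}" using F by (auto simp: Yb_def)
      then show ?thesis using F' by (auto simp: Xb_def generated_complex_def)
    qed
  next
    fix G assume "G \<in> {G. G - {a} \<in> Xa} \<union> {G. G - {b} \<in> Xb}"
    then consider F where "F \<in> ?T W" "F \<notin> Ya" "G - {a} \<subseteq> F"
      | F where "F \<in> ?T W" "F \<notin> Yb" "G - {b} \<subseteq> F"
      by (auto simp: Xa_def Xb_def generated_complex_def)
    then show "G \<in> generated_complex (?T V - S)"
    proof cases
      case (1 F)
      then have "insert a F \<in> ?T V - S" using insa notin by (auto simp: Ya_def)
      moreover have "G \<subseteq> insert a F" using 1 by auto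
      ultimately show ?thesis unfolding generated_complex_def by blast
    next
      case (2 F)
      then have "insert b F \<in> ?T V - S" using insb notin by (auto simp: Yb_def)
      moreover have "G \<subseteq> insert b F" using 2 by auto
      ultimately show ?thesis unfolding generated_complex_def by blast
    qed
  qed
  have ab: "a \<notin> \<Union>Xa" "b \<notin> \<Union>Xb" using subW by (auto simp: W_def)
  have IHa: "constructible_of_dim (int n) {G. G - {a} \<in> Xa}" if "Ya \<noteq> ?T W"
    using constructible_of_dim_cone[OF Suc.IH[OF W sYa that cW] ab(1)[unfolded Xa_def]]
    by (simp add: Xa_def)
  have IHb: "constructible_of_dim (int n) {G. G - {b} \<in> Xb}" if "Yb \<noteq> ?T W"
    using constructible_of_dim_cone[OF Suc.IH[OF W sYb that cW] ab(2)[unfolded Xb_def]]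
    by (simp add: Xb_def)
  have one: "Ya \<noteq> ?T W \<or> Yb \<noteq> ?T W"
  proof (rule ccontr)
    assume *: "\<not> ?thesis"
    obtain F where F: "F \<in> ?T V" "F \<notin> S" using Suc.prems(3) STV by blast
    have "F - {a, b} \<in> Ya" "F - {a, b} \<in> Yb" using remove[OF F(1)] * by auto
    then have "insert a (F - {a, b}) \<in> S" "insert b (F - {a, b}) \<in> S"
      unfolding Ya_def Yb_def by blast+
    then show False using remove[OF F(1)] F(2) by metis
  qed
  show ?case
  \<comment> \<open>If one link is everything, the star on that side is void and the other cone
    alone is the complement.\<close>
  proof (cases "Ya = ?T W \<or> Yb = ?T W")
    case True
    then consider "Ya = ?T W" | "Yb = ?T W" by blast
    then show ?thesis
    proof cases
      case 1
      then have "Xa = {}" by (simp add: Xa_def generated_complex_empty)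
      then show ?thesis using IHb one 1 unfolding split by simp
    next
      case 2
      then have "Xb = {}" by (simp add: Xb_def generated_complex_empty)
      then show ?thesis using IHa one 2 unfolding split by simp
    qed
  next
    case False
    have "{G. G - {a} \<in> Xa} \<inter> {G. G - {b} \<in> Xb} = Xa \<inter> Xb"
    proof (intro equalityI subsetI)
      fix G assume "G \<in> {G. G - {a} \<in> Xa} \<inter> {G. G - {b} \<in> Xb}"
      then have G: "G - {a} \<in> Xa" "G - {b} \<in> Xb" by auto
      \<comment> \<open>A face of the star of \<open>a\<close> avoids \<open>b\<close>, and vice
        versa; a common face therefore avoids both apexes.\<close>
      then have "a \<notin> G" "b \<notin> G"
        using subW[of "G - {a}"] subW[of "G - {b}"] b(2) by (auto simp: W_def)
      then show "G \<in> Xa \<inter> Xb" using G by simp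
    next
      fix G assume G: "G \<in> Xa \<inter> Xb"
      then have "a \<notin> G" "b \<notin> G" using subW[of G] by (auto simp: W_def)
      then show "G \<in> {G. G - {a} \<in> Xa} \<inter> {G. G - {b} \<in> Xb}" using G by simp
    qed
    also have int: "Xa \<inter> Xb = generated_complex (?T W - (Ya \<union> Yb))"
    proof
      show "generated_complex (?T W - (Ya \<union> Yb)) \<subseteq> Xa \<inter> Xb"
        by (auto simp: Xa_def Xb_def generated_complex_def)
      show "Xa \<inter> Xb \<subseteq> generated_complex (?T W - (Ya \<union> Yb))"
      proof
        fix G assume "G \<in> Xa \<inter> Xb"
        then obtain Fa Fb where Fa: "Fa \<in> ?T W" "Fa \<notin> Ya" "G \<subseteq> Fa"
          and Fb: "Fb \<in> ?T W" "Fb \<notin> Yb" "G \<subseteq> Fb"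
          by (auto simp: Xa_def Xb_def generated_complex_def)
        \<comment> \<open>Among the facets of the complement containing \<open>G\<close>, some
          contain \<open>a\<close> and some contain \<open>b\<close>. Connectedness yields a flip
          from the first kind to the second, which must exchange \<open>a\<close> for
          \<open>b\<close>; the common ridge then lies in neither \<open>Ya\<close> nor
          \<open>Yb\<close>.\<close>
        define P where "P = {F \<in> ?T V - S. G \<subseteq> F}"
        define C where "C = {F \<in> P. a \<in> F}"
        have "insert a Fa \<in> C"
          using Fa insa[of Fa] notin[OF Fa(1)] by (auto simp: Ya_def C_def P_def)
        moreover have "insert b Fb \<in> P" "insert b Fb \<notin> C"
          using Fb insb[of Fb] notin[OF Fb(1)] b(2) by (auto simp: Yb_def C_def P_def)
        moreover have "C \<subseteq> P" by (auto simp: C_def)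
        ultimately obtain F v
          where Fv: "F \<in> C" "v \<in> F - G" "flip opp v F \<notin> S" "flip opp v F \<notin> C"
          using shelled_complement_connected[OF S V, of C G, folded P_def] by blast
        then have F: "F \<in> ?T V" "F \<notin> S" "G \<subseteq> F" "a \<in> F" by (auto simp: C_def P_def)
        have "flip opp v F \<in> ?T V" using flip_in_transversals[OF V F(1)] Fv(2) by auto
        moreover have "G \<subseteq> flip opp v F" using F(3) Fv(2) by (auto simp: flip_def)
        ultimately have "a \<notin> flip opp v F" using Fv(3,4) by (auto simp: C_def P_def)
        then have "v = a" using F(4) by (auto simp: flip_def)
        have bF: "b \<notin> F" using transversalD(2)[OF F(1) a] F(4) by (simp add: b_def)
        have "flip opp v F = insert b (F - {a, b})" "F = insert a (F - {a, b})"
          using \<open>v = a\<close> bF F(4) by (auto simp: flip_def b_def)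
        then have "F - {a, b} \<notin> Ya \<union> Yb" using F(2) Fv(3) by (auto simp: Ya_def Yb_def)
        moreover have "G \<subseteq> F - {a, b}" using F(3) Fv(2) bF \<open>v = a\<close> by auto
        ultimately show "G \<in> generated_complex (?T W - (Ya \<union> Yb))"
          using remove[OF F(1)] unfolding generated_complex_def by blast
      qed
    qed
    finally have eq: "{G. G - {a} \<in> Xa} \<inter> {G. G - {b} \<in> Xb} = \<dots>" .
    \<comment> \<open>The empty face lies in both stars. By the description of the intersection, the
      union of the links then misses some facet, so the induction hypothesis applies to it.\<close>
    have "{} \<in> Xa \<inter> Xb"
      using False shelled_subset[OF sYa] shelled_subset[OF sYb]
      by (auto simp: Xa_def Xb_def empty_mem_generated_complex)
    then have "Ya \<union> Yb \<noteq> ?T W" unfolding int empty_mem_generated_complex by blast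
    from Suc.IH[OF W sYab this cW]
    have "constructible_of_dim (int n - 1) ({G. G - {a} \<in> Xa} \<inter> {G. G - {b} \<in> Xb})"
      unfolding eq .
    then show ?thesis
      unfolding split using IHa IHb False by (auto intro: constructible_of_dim.union)
  qed
qed

text \<open>Let \<open>F\<close> be the last facet of the shelling and \<open>S'\<close> the set of
  its predecessors, so that the complement of \<open>S'\<close> is \<open>insert F S\<close>. The
  facets there containing \<open>F \<inter> G\<close> are connected by flips, so some flip leads
  from \<open>F\<close> into \<open>S\<close> at a vertex outside \<open>G\<close>.\<close>

lemma shelling_reversal:
  assumes V: "antipodal opp V" and S: "S \<subset> transversals opp V"
    and "shelled opp V (transversals opp V - S)"
  shows "\<exists>F \<in> transversals opp V - S. \<forall>G\<in>S. \<exists>v\<in>F - G. flip opp v F \<in> S"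
  using assms(3)
proof cases
  case empty
  then show ?thesis using S by blast
next
  case (insert S' F)
  have FS: "F \<in> transversals opp V - S" and S': "S' \<subseteq> transversals opp V - S"
    using insert(1) by auto
  have FS': "F \<notin> S'" using insert(4) by blast
  have "\<exists>v\<in>F - G. flip opp v F \<in> S" if G: "G \<in> S" for G
  proof (rule ccontr)
    assume *: "\<not> ?thesis"
    \<comment> \<open>Otherwise every flip of \<open>F\<close> outside \<open>G\<close> stays in the
      complement of \<open>S\<close>, and \<open>{F}\<close> would be a whole connected component
      although \<open>G\<close> belongs to it.\<close>
    have "{F} = {E \<in> transversals opp V - S'. F \<inter> G \<subseteq> E}"
    proof (rule shelled_complement_connected[OF insert(2) V])
      show "{F} \<subseteq> {E \<in> transversals opp V - S'. F \<inter> G \<subseteq> E}" using FS FS' by auto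
      fix E v assume E: "E \<in> {F}" "v \<in> E - F \<inter> G" "flip opp v E \<notin> S'"
      then have v: "v \<in> F - G" by auto
      then have "flip opp v F \<in> transversals opp V - S"
        using * flip_in_transversals[OF V insert(3)] by auto
      then have "flip opp v F \<in> insert F S'" unfolding insert(1) .
      then show "flip opp v E \<in> {F}" using E by auto
    qed simp
    moreover have "G \<in> {E \<in> transversals opp V - S'. F \<inter> G \<subseteq> E}" using G S S' by auto
    ultimately show False using FS G by auto
  qed
  then show ?thesis using FS by blast
qed

section \<open>Shellable subcomplexes of a cross-polytope\<close>

lemma simplicial_complex_generated:
  assumes "finite S" "S \<noteq> {}" "\<And>F. F \<in> S \<Longrightarrow> finite F"
  shows "simplicial_complex (generated_complex S)"
proof -
  have "generated_complex S = (\<Union>F\<in>S. Pow F)" by (auto simp: generated_complex_def)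
  then have "finite (generated_complex S)" using assms by simp
  then show ?thesis
    using assms unfolding simplicial_complex_def generated_complex_def
    by (auto intro: finite_subset)
qed

lemma face_in_facet:
  assumes "simplicial_complex K" "G \<in> K"
  shows "\<exists>F\<in>facets K. G \<subseteq> F"
proof -
  have "finite K" using assms by (simp add: simplicial_complex_def)
  from finite_has_maximal2[OF this assms(2)]
  obtain F where "F \<in> K" "G \<subseteq> F" "\<forall>E\<in>K. F \<subseteq> E \<longrightarrow> F = E" by auto
  then show ?thesis by (intro bexI[of _ F]) (auto simp: facets_def)
qed

lemma generated_complex_facets:
  assumes "simplicial_complex K"
  shows "generated_complex (facets K) = K"
proof
  show "generated_complex (facets K) \<subseteq> K"
    using assms unfolding simplicial_complex_def generated_complex_def facets_def by blast
  show "K \<subseteq> generated_complex (facets K)"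
    using face_in_facet[OF assms] unfolding generated_complex_def by blast
qed

text \<open>Used for given complexes and also for every nonempty prefix of a shelling. The empty set
  of facets is excluded because it generates the void complex, which lacks the empty face.\<close>

locale facet_set =
  fixes opp :: "'a \<Rightarrow> 'a" and V :: "'a set" and n :: nat and S :: "'a set set"
  assumes V: "antipodal opp V" and card_V: "card V = 2 * n"
    and S: "S \<subseteq> transversals opp V" "S \<noteq> {}"
begin

lemma face_dim_transversal: "F \<in> transversals opp V \<Longrightarrow> face_dim F = int n - 1"
  using card_transversal[OF V] card_V by (simp add: face_dim_def)

lemma finite_transversal: "F \<in> transversals opp V \<Longrightarrow> finite F"
  using transversalD(1) antipodal_finite[OF V] finite_subset by metis

lemma simplicial_complex: "simplicial_complex (generated_complex S)"
  using S finite_transversal finite_subset[OF S(1) finite_transversals[OF V]]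
  by (intro simplicial_complex_generated) auto

lemma facets_generated: "facets (generated_complex S) = S"
proof
  show "facets (generated_complex S) \<subseteq> S"
    unfolding facets_def generated_complex_def by blast
  show "S \<subseteq> facets (generated_complex S)"
  proof
    fix F assume F: "F \<in> S"
    have "G = F" if "E \<in> S" "G \<subseteq> E" "F \<subseteq> G" for G E
      using transversal_subset_eq[of F opp V E] F S(1) that by auto
    then show "F \<in> facets (generated_complex S)"
      using F unfolding facets_def generated_complex_def by blast
  qed
qed

lemma complex_dim_generated: "complex_dim (generated_complex S) = int n - 1"
proof (rule complex_dim_eqI)
  show "finite (generated_complex S)" using simplicial_complex by (simp add: simplicial_complex_def)
  show "\<exists>F\<in>generated_complex S. face_dim F = int n - 1"
    using S face_dim_transversal unfolding generated_complex_def by blast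
  fix G assume "G \<in> generated_complex S"
  then obtain F where F: "F \<in> transversals opp V" "G \<subseteq> F" using S(1) by (auto simp: generated_complex_def)
  then have "card G \<le> card F" using finite_transversal by (intro card_mono)
  then show "face_dim G \<le> int n - 1" using face_dim_transversal[OF F(1)] by (simp add: face_dim_def)
qed

text \<open>A pure intersection of codimension one is a union of ridges \<open>F - {v}\<close> of
  \<open>F\<close>, and such a ridge lies in a member of \<open>S\<close> exactly if the flip at
  \<open>v\<close> is in \<open>S\<close>.\<close>

lemma shelling_step_iff:
  assumes F: "F \<in> transversals opp V" "F \<notin> S"
  shows "pure_of_dim (int n - 2) (generated_complex S \<inter> Pow F) \<longleftrightarrow>
    (\<forall>G\<in>S. \<exists>v\<in>F - G. flip opp v F \<in> S)"
proof
  assume pure: "pure_of_dim (int n - 2) (generated_complex S \<inter> Pow F)"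
  let ?K = "generated_complex S \<inter> Pow F"
  show "\<forall>G\<in>S. \<exists>v\<in>F - G. flip opp v F \<in> S"
  proof
    fix G assume "G \<in> S"
    then have "F \<inter> G \<in> ?K" by (auto simp: generated_complex_def)
    then obtain E where E: "E \<in> facets ?K" "F \<inter> G \<subseteq> E"
      using face_in_facet pure unfolding pure_of_dim_def by blast
    then have "face_dim E = int n - 2" using pure by (simp add: pure_of_dim_def)
    moreover have EF: "E \<subseteq> F" using E(1) by (auto simp: facets_def)
    moreover have "finite F" by (rule finite_transversal[OF F(1)])
    ultimately have "card (F - E) = 1"
      using face_dim_transversal[OF F(1)] finite_subset[OF EF]
      by (simp add: face_dim_def card_Diff_subset)
    then obtain v where v: "F - E = {v}" by (auto simp: card_1_singleton_iff)
    obtain G' where G': "G' \<in> S" "E \<subseteq> G'"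
      using E(1) by (auto simp: facets_def generated_complex_def)
    have G'T: "G' \<in> transversals opp V" using G'(1) S by auto
    have vF: "v \<in> F" "v \<in> V" using v transversalD(1)[OF F(1)] by auto
    \<comment> \<open>The facet \<open>G'\<close> contains the ridge but not \<open>v\<close>, as
      otherwise \<open>F = G'\<close> would be in \<open>S\<close>. Hence it contains
      \<open>opp v\<close> and is the flip.\<close>
    have "F - {v} \<subseteq> G'" using v G'(2) EF by auto
    moreover have "v \<notin> G'"
      using \<open>F - {v} \<subseteq> G'\<close> transversal_subset_eq[OF F(1) G'T] F(2) G'(1) by auto
    then have "opp v \<in> G'" using transversalD(2)[OF G'T vF(2)] by simp
    ultimately have "flip opp v F \<subseteq> G'" by (auto simp: flip_def)
    then have "flip opp v F = G'"
      using transversal_subset_eq[OF flip_in_transversals[OF V F(1) vF(1)] G'T] by simp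
    moreover have "v \<notin> G" using v E(2) by auto
    ultimately show "\<exists>v\<in>F - G. flip opp v F \<in> S" using vF G'(1) by blast
  qed
next
  assume *: "\<forall>G\<in>S. \<exists>v\<in>F - G. flip opp v F \<in> S"
  let ?K = "generated_complex S \<inter> Pow F"
  have "simplicial_complex (Pow F)"
    using finite_transversal[OF F(1)] unfolding simplicial_complex_def by (auto intro: finite_subset)
  then have "simplicial_complex ?K" by (rule simplicial_complex_Int[OF simplicial_complex])
  moreover have "face_dim E = int n - 2" if E: "E \<in> facets ?K" for E
  proof -
    from E obtain G where G: "G \<in> S" "E \<subseteq> G" "E \<subseteq> F"
      by (auto simp: facets_def generated_complex_def)
    from *[rule_format, OF G(1)] obtain v where v: "v \<in> F" "v \<notin> G" "flip opp v F \<in> S" by auto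
    \<comment> \<open>The ridge lies in the intersection and contains \<open>E\<close>, so the
      maximal face \<open>E\<close> equals it.\<close>
    then have "F - {v} \<in> ?K" by (auto simp: generated_complex_def flip_def)
    moreover have "E \<subseteq> F - {v}" using G v by auto
    ultimately have "F - {v} = E" using E unfolding facets_def by blast
    moreover have "card (F - {v}) = card F - 1" "card F > 0"
      using v(1) finite_transversal[OF F(1)] by (auto simp: card_gt_0_iff)
    ultimately show ?thesis
      using face_dim_transversal[OF F(1)] by (auto simp: face_dim_def)
  qed
  ultimately show "pure_of_dim (int n - 2) ?K" by (simp add: pure_of_dim_def)
qed

end

text \<open>Recovers the order that the inductive definition forgets: each inserted facet is
  appended at the end, and conversely all prefixes are shelled. For \<open>j = 0\<close> the
  condition is vacuous.\<close>

lemma shelled_iff_list: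
  "shelled opp V S \<longleftrightarrow> S \<subseteq> transversals opp V \<and> (\<exists>Fs. distinct Fs \<and> set Fs = S \<and>
    (\<forall>j<length Fs. \<forall>G\<in>set (take j Fs). \<exists>v\<in>Fs ! j - G. flip opp v (Fs ! j) \<in> set (take j Fs)))"
    (is "_ \<longleftrightarrow> _ \<and> (\<exists>Fs. distinct Fs \<and> set Fs = S \<and> ?P Fs)")
proof
  assume S: "shelled opp V S"
  have "\<exists>Fs. distinct Fs \<and> set Fs = S \<and> ?P Fs"
    using S
  proof induction
    case (insert S F)
    then obtain Fs where Fs: "distinct Fs" "set Fs = S" "?P Fs" by blast
    have "F \<notin> S" using insert.hyps(3) by blast
    then have "distinct (Fs @ [F])" "set (Fs @ [F]) = insert F S" using Fs by auto
    moreover have "?P (Fs @ [F])"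
    proof (intro allI impI)
      fix j assume "j < length (Fs @ [F])"
      then consider "j < length Fs" | "j = length Fs" by fastforce
      then show "\<forall>G\<in>set (take j (Fs @ [F])). \<exists>v\<in>(Fs @ [F]) ! j - G.
          flip opp v ((Fs @ [F]) ! j) \<in> set (take j (Fs @ [F]))"
      proof cases
        case 1
        then show ?thesis using Fs(3) by (simp add: nth_append)
      next
        case 2
        then show ?thesis using insert.hyps(3) Fs(2) by simp
      qed
    qed
    ultimately show ?case by blast
  qed simp
  then show "S \<subseteq> transversals opp V \<and> (\<exists>Fs. distinct Fs \<and> set Fs = S \<and> ?P Fs)"
    using shelled_subset[OF S] by blast
next
  assume "S \<subseteq> transversals opp V \<and> (\<exists>Fs. distinct Fs \<and> set Fs = S \<and> ?P Fs)"
  then obtain Fs where S: "S \<subseteq> transversals opp V" and Fs: "set Fs = S" "?P Fs" by blast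
  have "shelled opp V (set (take j Fs))" if "j \<le> length Fs" for j
    using that
  proof (induction j)
    case 0
    then show ?case by (simp add: shelled.empty)
  next
    case (Suc j)
    then have j: "j < length Fs" by simp
    have "set (take (Suc j) Fs) = insert (Fs ! j) (set (take j Fs))"
      using j by (simp add: take_Suc_conv_app_nth)
    moreover have "Fs ! j \<in> transversals opp V" using j S Fs(1) nth_mem by blast
    ultimately show ?case
      using Suc Fs(2) j by (auto intro!: shelled.insert)
  qed
  from this[of "length Fs"] show "shelled opp V S" using Fs(1) by simp
qed

lemma (in facet_set) shellable_iff_shelled: "shellable (generated_complex S) \<longleftrightarrow> shelled opp V S"
proof -
  let ?K = "generated_complex S"
  have step: "pure_of_dim (complex_dim ?K - 1) ((\<Union>i<j. Pow (Fs ! i)) \<inter> Pow (Fs ! j)) \<longleftrightarrow>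
      (\<forall>G\<in>set (take j Fs). \<exists>v\<in>Fs ! j - G. flip opp v (Fs ! j) \<in> set (take j Fs))"
    if Fs: "distinct Fs" "set Fs = S" and j: "0 < j" "j < length Fs" for Fs j
  proof -
    have sub: "set (take j Fs) \<subseteq> S" using Fs(2) set_take_subset[of j Fs] by simp
    have ne: "set (take j Fs) \<noteq> {}" using j by auto
    \<comment> \<open>A prefix generates a complex of the same dimension, so the criterion for one
      step applies to it. Nonemptiness uses \<open>0 < j\<close>.\<close>
    interpret prefix: facet_set opp V n "set (take j Fs)"
      using V card_V sub S(1) ne by unfold_locales auto
    have "set (take j Fs) = (!) Fs ` {..<j}"
      using j nth_image[of j Fs] by (simp add: atLeast0LessThan)
    then have "(\<Union>i<j. Pow (Fs ! i)) = generated_complex (set (take j Fs))"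
      by (auto simp: generated_complex_def)
    moreover have "Fs ! j \<in> transversals opp V" using j Fs(2) S(1) nth_mem by blast
    moreover have "Fs ! j \<notin> set (take j Fs)"
      using Fs(1) j by (auto simp: set_conv_nth nth_eq_iff_index_eq)
    ultimately show ?thesis
      using prefix.shelling_step_iff[of "Fs ! j"] by (simp add: complex_dim_generated)
  qed
  have "pure_of_dim (complex_dim ?K) ?K"
    using simplicial_complex face_dim_transversal S(1)
    by (auto simp: pure_of_dim_def facets_generated complex_dim_generated)
  then have "shellable ?K \<longleftrightarrow> (\<exists>Fs. is_shelling ?K Fs)" by (simp add: shellable_def)
  also have "\<dots> \<longleftrightarrow> shelled opp V S"
    unfolding shelled_iff_list is_shelling_def facets_generated
  proof (intro iffI conjI S(1); (elim conjE)?)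
    assume "\<exists>Fs. distinct Fs \<and> set Fs = S \<and> (\<forall>j. 0 < j \<and> j < length Fs \<longrightarrow>
      pure_of_dim (complex_dim ?K - 1) ((\<Union>i<j. Pow (Fs ! i)) \<inter> Pow (Fs ! j)))"
    then obtain Fs where Fs: "distinct Fs" "set Fs = S" and
      pure: "\<And>j. 0 < j \<Longrightarrow> j < length Fs \<Longrightarrow>
        pure_of_dim (complex_dim ?K - 1) ((\<Union>i<j. Pow (Fs ! i)) \<inter> Pow (Fs ! j))" by blast
    have "\<forall>G\<in>set (take j Fs). \<exists>v\<in>Fs ! j - G. flip opp v (Fs ! j) \<in> set (take j Fs)"
      if "j < length Fs" for j
    proof (cases "j = 0")
      case False
      then show ?thesis using pure[of j] step[OF Fs, of j] that by blast
    qed simp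
    then show "\<exists>Fs. distinct Fs \<and> set Fs = S \<and> (\<forall>j<length Fs. \<forall>G\<in>set (take j Fs).
        \<exists>v\<in>Fs ! j - G. flip opp v (Fs ! j) \<in> set (take j Fs))"
      using Fs by blast
  next
    assume "\<exists>Fs. distinct Fs \<and> set Fs = S \<and> (\<forall>j<length Fs. \<forall>G\<in>set (take j Fs).
        \<exists>v\<in>Fs ! j - G. flip opp v (Fs ! j) \<in> set (take j Fs))"
    then obtain Fs where Fs: "distinct Fs" "set Fs = S" and
      "\<And>j. j < length Fs \<Longrightarrow> \<forall>G\<in>set (take j Fs).
        \<exists>v\<in>Fs ! j - G. flip opp v (Fs ! j) \<in> set (take j Fs)" by blast
    then show "\<exists>Fs. distinct Fs \<and> set Fs = S \<and> (\<forall>j. 0 < j \<and> j < length Fs \<longrightarrow>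
      pure_of_dim (complex_dim ?K - 1) ((\<Union>i<j. Pow (Fs ! i)) \<inter> Pow (Fs ! j)))"
      using step[OF Fs] by blast
  qed
  finally show ?thesis .
qed

text \<open>A proper subset of a pair has at most one point, so a face of the join selects at most
  one point from each pair, and the map \<open>opp\<close> swaps the two points of a pair.\<close>

lemma join_of_pairs_eq_cross_polytope:
  fixes A :: "'i \<Rightarrow> 'a set"
  assumes "finite I" and pair: "\<forall>i\<in>I. card (A i) = 2" and disj: "disjoint_family_on A I"
  shows "\<exists>opp. antipodal opp (\<Union>i\<in>I. A i) \<and> card (\<Union>i\<in>I. A i) = 2 * card I \<and>
    join_family I (\<lambda>i. boundary_of_simplex (A i)) =
      generated_complex (transversals opp (\<Union>i\<in>I. A i))"
proof -
  let ?V = "\<Union>i\<in>I. A i"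
  have same: "i = j" if "i \<in> I" "j \<in> I" "v \<in> A i" "v \<in> A j" for i j v
    using disj that by (auto simp: disjoint_family_on_def)
  have "\<forall>v\<in>?V. \<exists>w. w \<noteq> v \<and> (\<exists>i\<in>I. A i = {v, w})"
  proof
    fix v assume "v \<in> ?V"
    then obtain i where i: "i \<in> I" "v \<in> A i" by blast
    then obtain x y where "A i = {x, y}" "x \<noteq> y" using pair by (auto simp: card_2_iff)
    then have "A i = {v, if v = x then y else x}" "(if v = x then y else x) \<noteq> v"
      using i(2) by auto
    then show "\<exists>w. w \<noteq> v \<and> (\<exists>i\<in>I. A i = {v, w})" using i(1) by blast
  qed
  then obtain opp where opp: "\<forall>v\<in>?V. opp v \<noteq> v \<and> (\<exists>i\<in>I. A i = {v, opp v})"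
    using bchoice[of ?V "\<lambda>v w. w \<noteq> v \<and> (\<exists>i\<in>I. A i = {v, w})"] by blast
  have Ai: "A i = {v, opp v}" "opp v \<noteq> v" if "i \<in> I" "v \<in> A i" for i v
  proof -
    have "v \<in> ?V" using that by blast
    then obtain j where j: "j \<in> I" "A j = {v, opp v}" "opp v \<noteq> v" using opp by blast
    then have "i = j" using same[of i j v] that by blast
    then show "A i = {v, opp v}" "opp v \<noteq> v" using j by auto
  qed
  have oppA: "opp v \<in> A i" "opp (opp v) = v" if "i \<in> I" "v \<in> A i" for i v
  proof -
    show "opp v \<in> A i" using Ai[OF that] by blast
    from Ai[OF that(1) this] Ai[OF that] show "opp (opp v) = v" by (metis doubleton_eq_iff)
  qed
  have fin: "finite (A i)" if "i \<in> I" for i using pair that by (metis card.infinite zero_neq_numeral)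
  have V: "antipodal opp ?V"
    unfolding antipodal_def
  proof (intro conjI ballI)
    show "finite ?V" using assms(1) fin by blast
    fix v assume "v \<in> ?V"
    then obtain i where i: "i \<in> I" "v \<in> A i" by blast
    show "opp v \<in> ?V" using oppA(1)[OF i] i(1) by blast
    show "opp v \<noteq> v" using Ai(2)[OF i] .
    show "opp (opp v) = v" using oppA(2)[OF i] .
  qed
  have "card ?V = (\<Sum>i\<in>I. card (A i))"
    using disj fin by (intro card_UN_disjoint assms(1)) (auto simp: disjoint_family_on_def)
  then have cV: "card ?V = 2 * card I" using pair by simp
  have "join_family I (\<lambda>i. boundary_of_simplex (A i)) = generated_complex (transversals opp ?V)"
  proof (intro equalityI subsetI)
    fix G assume "G \<in> join_family I (\<lambda>i. boundary_of_simplex (A i))"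
    then obtain f where f: "G = (\<Union>i\<in>I. f i)" "\<And>i. i \<in> I \<Longrightarrow> f i \<subset> A i"
      by (auto simp: join_family_def boundary_of_simplex_def)
    \<comment> \<open>If \<open>w\<close> is a point of the pair missing from \<open>f i\<close>,
      its partner \<open>opp w\<close> completes the selection; this also covers empty
      \<open>f i\<close>.\<close>
    have "\<exists>e. e \<in> A i \<and> f i \<subseteq> {e}" if i: "i \<in> I" for i
    proof -
      obtain w where w: "w \<in> A i" "w \<notin> f i" using f(2)[OF i] by blast
      have "f i \<subseteq> {w, opp w}" using f(2)[OF i] Ai(1)[OF i w(1)] by auto
      then have "f i \<subseteq> {opp w}" using w(2) by blast
      then show ?thesis using oppA(1)[OF i w(1)] by blast
    qed
    then obtain e where e: "\<And>i. i \<in> I \<Longrightarrow> e i \<in> A i \<and> f i \<subseteq> {e i}" by metis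
    have mem: "v \<in> e ` I \<longleftrightarrow> v = e i" if "i \<in> I" "v \<in> A i" for i v
      using e same that by blast
    have "e ` I \<in> transversals opp ?V"
      unfolding transversals_def
    proof (intro CollectI conjI ballI)
      show "e ` I \<subseteq> ?V" using e by blast
      fix v assume "v \<in> ?V"
      then obtain i where i: "i \<in> I" "v \<in> A i" by blast
      show "opp v \<in> e ` I \<longleftrightarrow> v \<notin> e ` I"
        using mem[OF i] mem[OF i(1) oppA(1)[OF i]] Ai[OF i] e[OF i(1)] by auto
    qed
    moreover have "G \<subseteq> e ` I" using f(1) e by blast
    ultimately show "G \<in> generated_complex (transversals opp ?V)"
      unfolding generated_complex_def by blast
  next
    fix G assume "G \<in> generated_complex (transversals opp ?V)"
    then obtain F where F: "F \<in> transversals opp ?V" "G \<subseteq> F" by (auto simp: generated_complex_def)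
    have "G = (\<Union>i\<in>I. G \<inter> A i)" using transversalD(1)[OF F(1)] F(2) by blast
    moreover have "G \<inter> A i \<subset> A i" if i: "i \<in> I" for i
    proof -
      obtain v where v: "v \<in> A i" using pair i by fastforce
      then have "v \<in> ?V" using i by blast
      then have "\<not> (v \<in> F \<and> opp v \<in> F)" using transversalD(2)[OF F(1)] by blast
      then show ?thesis using v oppA(1)[OF i v] F(2) by blast
    qed
    ultimately show "G \<in> join_family I (\<lambda>i. boundary_of_simplex (A i))"
      unfolding join_family_def boundary_of_simplex_def
      by (intro CollectI exI[of _ "\<lambda>i. G \<inter> A i"]) simp
  qed
  then show ?thesis using V cV by blast
qed

section \<open>Transfer of the results on shelled sets to the join of twelve pairs\<close>

theorem proposition8p7:
  fixes A :: "nat \<Rightarrow> 'a set" and H X Y :: "'a set set"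
  assumes "\<forall>i\<in>{1..12}. card (A i) = 2"
    and "disjoint_family_on A {1..12}"
    and "H = join_family {1..12} (\<lambda>i. boundary_of_simplex (A i))"
    and "full_dim_subcomplex Y H" and "Y \<noteq> H"
    and "shellable Y"
    and "\<forall>F\<in>facets H. F \<notin> Y \<longrightarrow> \<not> shellable (Y \<union> Pow F)"
    and "X = generated_complex (H - Y)"
  shows "full_dim_subcomplex X H \<and> cohen_macaulay TYPE('k::field) X \<and>
    \<not> shellable X \<and> constructible X"
proof -
  define V where "V = (\<Union>i\<in>{1..12}. A i)"
  obtain opp where V: "antipodal opp V" and cV: "card V = 2 * 12"
    and H: "H = generated_complex (transversals opp V)"
    using join_of_pairs_eq_cross_polytope[OF _ assms(1,2)] assms(3) unfolding V_def by auto
  define T where "T = transversals opp V"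
  define S where "S = facets Y"
  have Y: "simplicial_complex Y" "Y \<subseteq> H" and dimY: "complex_dim Y = complex_dim H"
    using assms(4) by (auto simp: full_dim_subcomplex_def)
  have YS: "Y = generated_complex S" using generated_complex_facets[OF Y(1)] by (simp add: S_def)
  have "{} \<in> Y" using Y(1) by (simp add: simplicial_complex_def)
  then have Sne: "S \<noteq> {}" and "{} \<in> H"
    using YS Y(2) by (auto simp: empty_mem_generated_complex)
  then have "T \<noteq> {}" using H by (simp add: T_def empty_mem_generated_complex)
  then interpret H: facet_set opp V 12 T
    using V cV by unfold_locales (auto simp: T_def)
  have dimH: "complex_dim H = 11" using H.complex_dim_generated H by (simp add: T_def)
  \<comment> \<open>Purity and full dimension force every facet of \<open>Y\<close> to have 12
    vertices, as many as the facet of \<open>H\<close> containing it.\<close>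
  have ST: "S \<subseteq> T"
  proof
    fix F assume "F \<in> S"
    then have F: "F \<in> Y" "face_dim F = 11"
      using assms(6) dimY dimH by (auto simp: S_def facets_def shellable_def pure_of_dim_def)
    then obtain F' where F': "F' \<in> T" "F \<subseteq> F'"
      using Y(2) H by (auto simp: generated_complex_def T_def)
    then have "card F = card F'" "finite F'"
      using H.face_dim_transversal H.finite_transversal F(2) by (auto simp: face_dim_def T_def)
    then show "F \<in> T" using F' card_subset_eq by metis
  qed
  then interpret Y: facet_set opp V 12 S
    using V cV Sne by unfold_locales (auto simp: T_def)
  have shS: "shelled opp V S" using Y.shellable_iff_shelled assms(6) YS by simp
  have "S \<noteq> T" using assms(5) YS H by (auto simp: T_def)
  then interpret X: facet_set opp V 12 "T - S"
    using V cV ST by unfold_locales (auto simp: T_def)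
  \<comment> \<open>A face outside \<open>Y\<close> lies in some facet of \<open>H\<close>, which
    cannot be a facet of \<open>Y\<close>. Conversely, a facet of \<open>H\<close> lying in
    \<open>Y\<close> would be contained in, and so equal to, a facet of \<open>Y\<close>.\<close>
  have X: "X = generated_complex (T - S)"
  proof (intro equalityI subsetI)
    fix G assume "G \<in> X"
    then obtain G' where "G' \<in> H" "G' \<notin> Y" "G \<subseteq> G'"
      unfolding assms(8) by (auto simp: generated_complex_def)
    moreover from this obtain F where "F \<in> T" "G' \<subseteq> F"
      using H by (auto simp: generated_complex_def T_def)
    ultimately show "G \<in> generated_complex (T - S)"
      using YS unfolding generated_complex_def by blast
  next
    fix G assume "G \<in> generated_complex (T - S)"
    then obtain F where F: "F \<in> T" "F \<notin> S" "G \<subseteq> F" by (auto simp: generated_complex_def)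
    have "F \<notin> Y"
      using F ST transversal_subset_eq[of F opp V] YS unfolding generated_complex_def T_def by blast
    moreover have "F \<in> H" using F H by (auto simp: generated_complex_def T_def)
    ultimately show "G \<in> X" using F(3) unfolding assms(8) generated_complex_def by blast
  qed
  have con: "constructible_of_dim 11 X"
    using shelled_complement_constructible[OF V shS _ cV] \<open>S \<noteq> T\<close> X by (simp add: T_def)
  have "X \<subseteq> H" unfolding X H T_def generated_complex_def by blast
  then have "full_dim_subcomplex X H"
    using X.simplicial_complex X.complex_dim_generated X dimH by (simp add: full_dim_subcomplex_def)
  moreover have "cohen_macaulay TYPE('k) X" by (rule cohen_macaulay_constructible[OF con])
  moreover have "constructible X"
    using con complex_dim_constructible[OF con] by (simp add: constructible_def)
  moreover have "\<not> shellable X"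
  proof
    assume "shellable X"
    then have "shelled opp V (transversals opp V - S)"
      using X.shellable_iff_shelled X by (simp add: T_def)
    moreover have "S \<subset> transversals opp V" using ST \<open>S \<noteq> T\<close> by (auto simp: T_def)
    ultimately obtain F where F: "F \<in> T" "F \<notin> S" "\<forall>G\<in>S. \<exists>v\<in>F - G. flip opp v F \<in> S"
      using shelling_reversal[OF V, of S] unfolding T_def by auto
    \<comment> \<open>The reversed last facet \<open>F\<close> satisfies the shelling condition over
      \<open>S\<close>, so \<open>Y \<union> Pow F\<close> is shellable, against the choice of
      \<open>Y\<close>.\<close>
    then have sh: "shelled opp V (insert F S)"
      using shS by (intro shelled.insert) (auto simp: T_def)
    interpret YF: facet_set opp V 12 "insert F S"
      using V cV ST F(1) by unfold_locales (auto simp: T_def)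
    have "generated_complex (insert F S) = Y \<union> Pow F"
      unfolding YS by (auto simp: generated_complex_def)
    then have "shellable (Y \<union> Pow F)" using YF.shellable_iff_shelled sh by simp
    moreover have "F \<in> facets H" using F(1) H.facets_generated H by (simp add: T_def)
    moreover have "F \<notin> Y"
      using F ST transversal_subset_eq[of F opp V] YS unfolding generated_complex_def T_def by blast
    ultimately show False using assms(7) by blast
  qed
  ultimately show ?thesis by blast
qed

end
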